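(* Let $M$ be one of the three speedup models roofline, communication, Amdahl, and let $\mu^M$ be respectively $\frac{3-\sqrt5}{2}$, $\frac{23-\sqrt{313}}{18}$, $\frac{1-\sqrt{8\sqrt2-11}}{2}$. Then there is no online list scheduling algorithm making deterministic local decisions whose competitive ratio, for task graphs all of whose tasks follow model $M$, is strictly less than $\frac{1}{\mu^M}$. That is, for every such algorithm $\mathcal A$ there is no real $\rho<\frac1{\mu^M}$ such that, for every number $P$ of processors and every finite directed acyclic graph of tasks following model $M$, the makespan $T$ of $\mathcal A$ satisfies $T\le\rho\,T^{\mathrm{opt}}$.
   Context: Problem. A finite DAG of tasks is to be executed on $P$ identical processors. An edge $(i,j)$ means that task $j$ cannot start before task $i$ is completed. Tasks are moldable: when task $j$ starts, an integer number $p\in\{1,\dots,P\}$ of processors is chosen for it; it then runs without interruption on exactly $p$ processors for time $t_j(p)$. At any time at most $P$ processors are in use. Online setting: a task becomes available (and its parameters become known) only when all its predecessors are completed. The makespan is the completion time of the last task; $T^{\mathrm{opt}}$ is the minimum makespan over all feasible (offline) schedules. Speedup models (parameters are nonnegative reals such that execution times are positive): roofline: $t_j(p)=\frac{w_j}{\min(p,\bar p_j)}$ with integer $1\le\bar p_j\le P$; communication: $t_j(p)=\frac{w_j}{p}+c_j(p-1)$; Amdahl: $t_j(p)=\frac{w_j}{p}+d_j$. Deterministic local decisions: the number of processors that the algorithm allocates to a task is a deterministic function of only the total number $P$ of processors and the parameters of the task's speedup function; hence two identical tasks always receive the same allocation, regardless of their positions in the graph and of the graph structure. List scheduling: at time $0$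 and whenever a running task completes, the algorithm scans all available tasks not yet started (in some order) and starts each one immediately, on its allocated number of processors, if at least that many processors are idle. *)

theory Defs
  imports Complex_Main
begin

section \<open>Moldable tasks and their speedup models\<close>

datatype model = Roofline | Communication | Amdahl

text \<open>The second parameter is, respectively, the maximal degree of parallelism, the
  communication overhead and the sequential time; the first one is always the work.\<close>

datatype speedup = SRoofline real nat | SCommunication real real | SAmdahl real real

fun exec_time :: "speedup \<Rightarrow> nat \<Rightarrow> real" where
  "exec_time (SRoofline w pbar) p = w / real (min p pbar)"
| "exec_time (SCommunication w c) p = w / real p + c * (real p - 1)"
| "exec_time (SAmdahl w d) p = w / real p + d"

fun model_params :: "model \<Rightarrow> nat \<Rightarrow> speedup \<Rightarrow> bool" where
  "model_params Roofline P (SRoofline w pbar) \<longleftrightarrow> 0 \<le> w \<and> 1 \<le> pbar \<and> pbar \<le> P"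
| "model_params Communication P (SCommunication w c) \<longleftrightarrow> 0 \<le> w \<and> 0 \<le> c"
| "model_params Amdahl P (SAmdahl w d) \<longleftrightarrow> 0 \<le> w \<and> 0 \<le> d"
| "model_params _ P _ \<longleftrightarrow> False"

definition follows_model :: "model \<Rightarrow> nat \<Rightarrow> speedup \<Rightarrow> bool" where
  "follows_model M P s \<longleftrightarrow> model_params M P s \<and> (\<forall>p\<in>{1..P}. 0 < exec_time s p)"

fun mu :: "model \<Rightarrow> real" where
  "mu Roofline = (3 - sqrt 5) / 2"
| "mu Communication = (23 - sqrt 313) / 18"
| "mu Amdahl = (1 - sqrt (8 * sqrt 2 - 11)) / 2"

section \<open>Task graphs and schedules\<close>

record task_graph =
  tasks :: "nat set"
  edges :: "(nat \<times> nat) set"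
  speedup_of :: "nat \<Rightarrow> speedup"

definition task_graph_of_model :: "model \<Rightarrow> nat \<Rightarrow> task_graph \<Rightarrow> bool" where
  "task_graph_of_model M P G \<longleftrightarrow>
     finite (tasks G) \<and> edges G \<subseteq> tasks G \<times> tasks G \<and> acyclic (edges G) \<and>
     (\<forall>j\<in>tasks G. follows_model M P (speedup_of G j))"

record schedule =
  start :: "nat \<Rightarrow> real"
  procs :: "nat \<Rightarrow> nat"

definition completion :: "task_graph \<Rightarrow> schedule \<Rightarrow> nat \<Rightarrow> real" where
  "completion G S j = start S j + exec_time (speedup_of G j) (procs S j)"

definition feasible :: "nat \<Rightarrow> task_graph \<Rightarrow> schedule \<Rightarrow> bool" where
  "feasible P G S \<longleftrightarrow>
     (\<forall>j\<in>tasks G. 0 \<le> start S j \<and> procs S j \<in> {1..P}) \<and>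
     (\<forall>(i, j)\<in>edges G. completion G S i \<le> start S j) \<and>
     (\<forall>t. (\<Sum>j | j \<in> tasks G \<and> start S j \<le> t \<and> t < completion G S j. procs S j) \<le> P)"

text \<open>The inserted \<open>0\<close> only matters for the graph without tasks.\<close>

definition makespan :: "task_graph \<Rightarrow> schedule \<Rightarrow> real" where
  "makespan G S = Max (insert 0 (completion G S ` tasks G))"

text \<open>The infimum is attained: there are finitely many allocations, and for each of them
  shifting tasks to the left leads to finitely many candidate schedules.\<close>

definition opt_makespan :: "nat \<Rightarrow> task_graph \<Rightarrow> real" where
  "opt_makespan P G = Inf {makespan G S | S. feasible P G S}"

section \<open>Online list scheduling with deterministic local decisions\<close>

text \<open>What an online algorithm knows at time \<open>v_time\<close>: the tasks that have become available so
  far, their parameters, the edges between them, and the start times of those that were started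
  strictly earlier. Completion and release times are determined by these data and the
  allocations, so this is the complete history.\<close>

record view =
  v_time :: real
  v_tasks :: "nat set"
  v_edges :: "(nat \<times> nat) set"
  v_speedup :: "nat \<Rightarrow> speedup option"
  v_start :: "nat \<Rightarrow> real option"

definition revealed :: "task_graph \<Rightarrow> schedule \<Rightarrow> real \<Rightarrow> nat set" where
  "revealed G S t = {j \<in> tasks G. \<forall>i. (i, j) \<in> edges G \<longrightarrow> completion G S i \<le> t}"

definition view_at :: "task_graph \<Rightarrow> schedule \<Rightarrow> real \<Rightarrow> view" where
  "view_at G S t =
     \<lparr> v_time = t,
       v_tasks = revealed G S t,
       v_edges = edges G \<inter> revealed G S t \<times> revealed G S t,
       v_speedup = (\<lambda>j. if j \<in> revealed G S t then Some (speedup_of G j) else None),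
       v_start = (\<lambda>j. if j \<in> revealed G S t \<and> start S j < t then Some (start S j) else None) \<rparr>"

definition pending :: "view \<Rightarrow> nat set" where
  "pending v = {j \<in> v_tasks v. v_start v j = None}"

text \<open>The allocation sees only the number of processors and the parameters of the task;
  the scan order may depend on the number of processors and the whole history.\<close>

record algorithm =
  alloc :: "nat \<Rightarrow> speedup \<Rightarrow> nat"
  scan_order :: "nat \<Rightarrow> view \<Rightarrow> nat list"

definition online_list_algorithm :: "model \<Rightarrow> algorithm \<Rightarrow> bool" where
  "online_list_algorithm M A \<longleftrightarrow>
     (\<forall>P\<ge>1. \<forall>s. follows_model M P s \<longrightarrow> alloc A P s \<in> {1..P}) \<and>
     (\<forall>P\<ge>1. \<forall>v. finite (v_tasks v) \<longrightarrow>
        distinct (scan_order A P v) \<and> set (scan_order A P v) = pending v)"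

text \<open>The tasks started by a scan of a list when the given number of processors is idle.\<close>

fun scan :: "(nat \<Rightarrow> nat) \<Rightarrow> nat \<Rightarrow> nat list \<Rightarrow> nat set" where
  "scan a idle [] = {}"
| "scan a idle (j # js) =
     (if a j \<le> idle then insert j (scan a (idle - a j) js) else scan a idle js)"

definition decision_times :: "task_graph \<Rightarrow> schedule \<Rightarrow> real set" where
  "decision_times G S = insert 0 (completion G S ` tasks G)"

definition idle_procs :: "nat \<Rightarrow> task_graph \<Rightarrow> schedule \<Rightarrow> real \<Rightarrow> nat" where
  "idle_procs P G S t =
     P - (\<Sum>j | j \<in> tasks G \<and> start S j < t \<and> t < completion G S j. procs S j)"

text \<open>The schedule produced by the algorithm. As execution times are positive, the decisions
  taken before a time \<open>t\<close> determine those taken at \<open>t\<close>; hence these conditions determine the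
  schedule on the tasks of the graph uniquely.\<close>

definition produces :: "algorithm \<Rightarrow> nat \<Rightarrow> task_graph \<Rightarrow> schedule \<Rightarrow> bool" where
  "produces A P G S \<longleftrightarrow>
     (\<forall>j\<in>tasks G. procs S j = alloc A P (speedup_of G j)) \<and>
     (\<forall>j\<in>tasks G. start S j \<in> decision_times G S) \<and>
     (\<forall>t\<in>decision_times G S.
        {j \<in> tasks G. start S j = t} =
          scan (procs S) (idle_procs P G S t) (scan_order A P (view_at G S t)))"

definition competitive :: "model \<Rightarrow> algorithm \<Rightarrow> real \<Rightarrow> bool" where
  "competitive M A \<rho> \<longleftrightarrow>
     (\<forall>P\<ge>1. \<forall>G S. task_graph_of_model M P G \<longrightarrow> produces A P G S \<longrightarrow>
        makespan G S \<le> \<rho> * opt_makespan P G)"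

end

theory Submission
  imports Defs
begin

text \<open>If an algorithm guarantees a ratio \<open>r\<close>, then it allocates at least \<open>P / r\<close> processors to a task
  \<open>X\<close> whose execution time on \<open>p\<close> processors is \<open>e / p\<close>. The adversary releases tasks \<open>B\<close> that
  together occupy slightly more than \<open>(1 - 1 / r) P\<close> processors, and only then reveals such a short
  task \<open>X\<close>, which must therefore wait for the \<open>B\<close> although the next group of tasks \<open>B\<close> depends on
  it. After many such stages comes a long chain of tasks \<open>C\<close>. An offline schedule executes the
  \<open>X\<close> first, and then all the \<open>B\<close> in parallel with the chain. If the algorithm stretches \<open>C\<close> by a
  factor \<open>\<beta>\<close> and increases the area of \<open>B\<close> by a factor \<open>\<alpha>\<close>, this yields
  \<open>\<beta> + \<alpha> r / (r - 1) \<le> r\<close>. For the roofline model \<open>\<alpha>, \<beta> \<ge> 1\<close> suffices. For the Amdahl model, with work \<open>w\<close>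
  much larger than the sequential time and \<open>q\<close> allocated processors, \<open>\<alpha>\<close> is about \<open>1 + q / w\<close> and
  \<open>\<beta>\<close> about \<open>1 + w / q\<close>. For the communication model one looks at the work at which the
  allocation changes from one processor to more; the worst case is \<open>w = 6 c\<close>, with \<open>\<beta> = 3 / 2\<close> just
  below and \<open>\<alpha> = 4 / 3\<close> just above.\<close>


section \<open>List scheduling\<close>

lemma scan_subset: "scan a n js \<subseteq> set js"
  by (induction a n js rule: scan.induct) auto

lemma scan_all: "sum_list (map a js) \<le> n \<Longrightarrow> scan a n js = set js"
  by (induction a n js rule: scan.induct) auto

lemma scan_mem_le: "j \<in> scan a n js \<Longrightarrow> a j \<le> n"
  by (induction a n js rule: scan.induct) (auto split: if_splits)

lemma scan_sum_le: "distinct js \<Longrightarrow> sum a (scan a n js) \<le> n"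
proof (induction a n js rule: scan.induct)
  case (2 a n j js)
  have "finite (scan a (n - a j) js)" "j \<notin> scan a (n - a j) js"
    using scan_subset[of a "n - a j" js] 2 by (auto intro: finite_subset)
  then show ?case using 2 by auto
qed simp

lemma revealed_subset: "revealed G S t \<subseteq> tasks G"
  by (auto simp: revealed_def)

lemma pending_view_at:
  "pending (view_at G S t) = {j \<in> revealed G S t. t \<le> start S j}"
  by (auto simp: pending_def view_at_def)

lemma exec_time_pos:
  "task_graph_of_model M P G \<Longrightarrow> j \<in> tasks G \<Longrightarrow> p \<in> {1..P} \<Longrightarrow> 0 < exec_time (speedup_of G j) p"
  by (auto simp: task_graph_of_model_def follows_model_def)

lemma alloc_range:
  assumes "online_list_algorithm M A" "P \<ge> 1" "follows_model M P s"
  shows "alloc A P s \<in> {1..P}"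
  using assms by (auto simp: online_list_algorithm_def)

lemma scan_order_props:
  assumes "online_list_algorithm M A" "P \<ge> 1" "task_graph_of_model M P G"
  shows "distinct (scan_order A P (view_at G S t))"
    and "set (scan_order A P (view_at G S t)) = {j \<in> revealed G S t. t \<le> start S j}"
proof -
  have "finite (v_tasks (view_at G S t))"
    using assms(3) finite_subset[OF revealed_subset]
    by (auto simp: view_at_def task_graph_of_model_def)
  then show "distinct (scan_order A P (view_at G S t))"
    and "set (scan_order A P (view_at G S t)) = {j \<in> revealed G S t. t \<le> start S j}"
    using assms(1,2) pending_view_at by (auto simp: online_list_algorithm_def)
qed

section \<open>Existence of the schedule of an algorithm\<close>

text \<open>Decisions at time \<open>t\<close> only depend on the start times before \<open>t\<close>, so unstarted tasks may
  be given arbitrary start times from \<open>t\<close> on.\<close>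

definition agree_before :: "task_graph \<Rightarrow> real \<Rightarrow> schedule \<Rightarrow> schedule \<Rightarrow> bool" where
  "agree_before G t S S' \<longleftrightarrow> procs S = procs S' \<and>
     (\<forall>j\<in>tasks G. start S j = start S' j \<or> t \<le> start S j \<and> t \<le> start S' j)"

lemma agree_before_mono: "agree_before G t S S' \<Longrightarrow> t' \<le> t \<Longrightarrow> agree_before G t' S S'"
  unfolding agree_before_def by fastforce

text \<open>Execution times are positive, so a task that starts at or after \<open>t\<close>
  completes after \<open>t\<close>. What is revealed and what is still running at \<open>t\<close>
  is therefore fixed by the starts before \<open>t\<close>.\<close>

lemma agree_before_decisions:
  assumes ag: "agree_before G t S S'" and sub: "edges G \<subseteq> tasks G \<times> tasks G"
    and pos: "\<And>j. j \<in> tasks G \<Longrightarrow> 0 < exec_time (speedup_of G j) (procs S j)"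
  shows "view_at G S t = view_at G S' t" "idle_procs P G S t = idle_procs P G S' t"
proof -
  have p: "procs S' = procs S" using ag by (simp add: agree_before_def)
  have c: "completion G S i \<le> t \<longleftrightarrow> completion G S' i \<le> t" if "i \<in> tasks G" for i
    using ag pos[OF that] that by (fastforce simp: agree_before_def completion_def)
  have r: "revealed G S t = revealed G S' t"
    using c sub by (auto simp: revealed_def)
  have st: "start S j < t \<longleftrightarrow> start S' j < t" "start S j < t \<Longrightarrow> start S j = start S' j"
    if "j \<in> tasks G" for j
    using ag that by (fastforce simp: agree_before_def)+
  show "view_at G S t = view_at G S' t"
    using r st revealed_subset[of G S' t] by (fastforce simp: view_at_def)
  have "{j \<in> tasks G. start S j < t \<and> t < completion G S j} =
        {j \<in> tasks G. start S' j < t \<and> t < completion G S' j}"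
    using st by (auto simp: completion_def p)
  then show "idle_procs P G S t = idle_procs P G S' t"
    by (simp add: idle_procs_def p)
qed

definition scan_at :: "algorithm \<Rightarrow> nat \<Rightarrow> task_graph \<Rightarrow> schedule \<Rightarrow> real \<Rightarrow> nat set" where
  "scan_at A P G S t = scan (procs S) (idle_procs P G S t) (scan_order A P (view_at G S t))"

text \<open>The timing conditions of \<open>produces\<close> cut off at \<open>t\<close>: start
  times from \<open>t\<close> on are mere placeholders.\<close>

definition produces_before :: "algorithm \<Rightarrow> nat \<Rightarrow> task_graph \<Rightarrow> schedule \<Rightarrow> real \<Rightarrow> bool" where
  "produces_before A P G S t \<longleftrightarrow>
     procs S = (\<lambda>j. alloc A P (speedup_of G j)) \<and>
     (\<forall>j\<in>tasks G. 0 \<le> start S j) \<and>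
     (\<forall>j\<in>tasks G. start S j < t \<longrightarrow> start S j \<in> decision_times G S) \<and>
     (\<forall>t'\<in>decision_times G S. t' < t \<longrightarrow> {j \<in> tasks G. start S j = t'} = scan_at A P G S t')"

lemma scan_at_subset:
  assumes "online_list_algorithm M A" "P \<ge> 1" "task_graph_of_model M P G"
  shows "scan_at A P G S t \<subseteq> {j \<in> revealed G S t. t \<le> start S j}"
  using scan_subset scan_order_props(2)[OF assms] unfolding scan_at_def by blast

text \<open>One round of a simulation: the tasks chosen by the scan at \<open>t\<close> start, and
  all other unstarted ones are parked beyond \<open>t + K\<close>. Nothing is decided between
  \<open>t\<close> and the next completion \<open>t2\<close>, so the invariant advances to
  \<open>t2\<close>.\<close>

lemma produces_before_step:
  assumes alg: "online_list_algorithm M A" and P: "P \<ge> 1" and G: "task_graph_of_model M P G"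
    and S: "produces_before A P G S t" and t: "t \<in> decision_times G S" and t0: "0 \<le> t"
  obtains S' where "procs S' = procs S" "\<And>j. start S j < t \<Longrightarrow> start S' j = start S j"
    "\<And>j. j \<in> tasks G \<Longrightarrow> start S j \<ge> t \<Longrightarrow> start S' j = t \<or> t + K < start S' j"
    "{j \<in> tasks G. start S' j = t} = scan_at A P G S' t"
    "\<And>t2. t < t2 \<Longrightarrow> t2 \<le> t + K \<Longrightarrow> (\<And>j. j \<in> tasks G \<Longrightarrow> start S' j \<le> t \<Longrightarrow> completion G S' j \<le> t \<or> t2 \<le> completion G S' j)
       \<Longrightarrow> produces_before A P G S' t2"
proof -
  have pr: "procs S = (\<lambda>j. alloc A P (speedup_of G j))"
    using S by (simp add: produces_before_def)
  have sub: "edges G \<subseteq> tasks G \<times> tasks G" using G by (simp add: task_graph_of_model_def)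
  have pos: "0 < exec_time (speedup_of G j) (procs S j)" if "j \<in> tasks G" for j
    using exec_time_pos[OF G that] alloc_range[OF alg P] G that
    by (auto simp: pr task_graph_of_model_def)
  \<comment> \<open>\<open>K\<close> is arbitrary here; the absolute value puts the placeholder both
    after \<open>t\<close> and after \<open>t + K\<close>.\<close>
  define S' where "S' = S\<lparr>start := \<lambda>j. if start S j < t then start S j
     else if j \<in> scan_at A P G S t then t else t + \<bar>K\<bar> + 1\<rparr>"
  have ag: "agree_before G t S S'" by (auto simp: agree_before_def S'_def)
  have sc: "scan_at A P G S' t' = scan_at A P G S t'" if "t' \<le> t" for t'
    using agree_before_decisions[OF agree_before_mono[OF ag that] sub pos]
    by (simp add: scan_at_def S'_def)
  have now: "{j \<in> tasks G. start S' j = t} = scan_at A P G S' t"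
  proof -
    have "scan_at A P G S t \<subseteq> {j \<in> tasks G. \<not> start S j < t}"
      using scan_at_subset[OF alg P G, of S t] revealed_subset[of G S t] by auto
    then have "{j \<in> tasks G. start S' j = t} = scan_at A P G S t"
      by (auto simp: S'_def)
    then show ?thesis using sc by simp
  qed
  show thesis
  proof (rule that[of S'])
    show "procs S' = procs S" "\<And>j. start S j < t \<Longrightarrow> start S' j = start S j"
      "{j \<in> tasks G. start S' j = t} = scan_at A P G S' t"
      "\<And>j. j \<in> tasks G \<Longrightarrow> start S j \<ge> t \<Longrightarrow> start S' j = t \<or> t + K < start S' j"
      using now by (auto simp: S'_def)
    fix t2 assume t2: "t < t2" "t2 \<le> t + K"
      and nx: "\<And>j. j \<in> tasks G \<Longrightarrow> start S' j \<le> t \<Longrightarrow> completion G S' j \<le> t \<or> t2 \<le> completion G S' j"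
    have cp: "completion G S j = completion G S' j" if "start S j < t" for j
      using that by (simp add: S'_def completion_def)
    have late: "t < completion G S j" "t < completion G S' j" if "j \<in> tasks G" "t \<le> start S j" for j
      using pos[OF that(1)] that(2) by (auto simp: S'_def completion_def)
    have dec: "t' \<in> decision_times G S \<longleftrightarrow> t' \<in> decision_times G S'" if "t' \<le> t" for t'
    proof -
      have "t' = completion G S j \<longleftrightarrow> t' = completion G S' j" if "j \<in> tasks G" for j
        using cp[of j] late[OF that] \<open>t' \<le> t\<close> by (cases "start S j < t") auto
      then show ?thesis by (auto simp: decision_times_def)
    qed
    \<comment> \<open>Parked tasks complete after \<open>t2\<close>, and by \<open>nx\<close> no
      started task completes strictly between \<open>t\<close> and \<open>t2\<close>.\<close>
    have past: "t' \<le> t" if "t' \<in> decision_times G S'" "t' < t2" for t'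
    proof -
      { fix j assume j: "j \<in> tasks G" "t' = completion G S' j"
        have "start S' j \<le> t" 
        proof (rule ccontr)
          assume "\<not> start S' j \<le> t"
          then have "start S' j = t + \<bar>K\<bar> + 1" by (auto simp: S'_def split: if_splits)
          then show False using pos[OF j(1)] j(2) that(2) t2 by (simp add: completion_def S'_def)
        qed
        then have ?thesis using nx[OF j(1)] j(2) that(2) by auto }
      then show ?thesis using that(1) t0 by (auto simp: decision_times_def)
    qed
    show "produces_before A P G S' t2"
      unfolding produces_before_def
    proof (intro conjI ballI impI)
      show "procs S' = (\<lambda>j. alloc A P (speedup_of G j))" by (simp add: S'_def pr)
      fix j assume j: "j \<in> tasks G"
      show "0 \<le> start S' j" using S j t0 by (simp add: S'_def produces_before_def)
      assume "start S' j < t2"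
      then have "start S' j \<le> t" using t2 by (auto simp: S'_def split: if_splits)
      then show "start S' j \<in> decision_times G S'"
        using S j t dec by (auto simp: S'_def produces_before_def split: if_splits)
    next
      fix t' assume t': "t' \<in> decision_times G S'" "t' < t2"
      from past[OF this] consider "t' < t" | "t' = t" by linarith
      then show "{j \<in> tasks G. start S' j = t'} = scan_at A P G S' t'"
      proof cases
        case 1
        then have "{j \<in> tasks G. start S' j = t'} = {j \<in> tasks G. start S j = t'}"
          by (auto simp: S'_def)
        also have "\<dots> = scan_at A P G S t'"
          using S 1 dec[of t'] t' by (simp add: produces_before_def)
        finally show ?thesis using sc 1 by simp
      qed (use now in simp)
    qed
  qed
qed

text \<open>Induction on the number of tasks not completed by \<open>t\<close>, jumping from one
  completion to the next. When nothing runs after a scan, acyclicity forces all tasks to be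
  done.\<close>

lemma produces_before_extend:
  assumes alg: "online_list_algorithm M A" and P: "P \<ge> 1" and G: "task_graph_of_model M P G"
  shows "produces_before A P G S t \<Longrightarrow> t \<in> decision_times G S \<Longrightarrow> 0 \<le> t \<Longrightarrow> \<exists>S'. produces A P G S'"
proof (induction "card {j \<in> tasks G. t < completion G S j}" arbitrary: S t rule: less_induct)
  case less
  note S = less.prems(1) and t = less.prems(2) and t0 = less.prems(3)
  have fin: "finite (tasks G)" and sub: "edges G \<subseteq> tasks G \<times> tasks G" and ac: "acyclic (edges G)"
    using G by (auto simp: task_graph_of_model_def)
  have pr: "procs S = (\<lambda>j. alloc A P (speedup_of G j))"
    using S by (simp add: produces_before_def)
  have pR: "procs S j \<in> {1..P}" if "j \<in> tasks G" for j
    using alloc_range[OF alg P] G that by (auto simp: pr task_graph_of_model_def)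
  have pos: "0 < exec_time (speedup_of G j) (procs S j)" if "j \<in> tasks G" for j
    using exec_time_pos[OF G that] pR[OF that] by auto
  \<comment> \<open>An upper bound on every execution time, so that the next completion lies within
    the horizon \<open>t + K\<close>.\<close>
  define K where "K = (\<Sum>j\<in>tasks G. exec_time (speedup_of G j) (procs S j))"
  have K: "exec_time (speedup_of G j) (procs S j) \<le> K" if "j \<in> tasks G" for j
    unfolding K_def using that fin pos by (intro member_le_sum) (auto intro: less_imp_le)
  obtain S' where S': "procs S' = procs S" "\<And>j. start S j < t \<Longrightarrow> start S' j = start S j"
    "\<And>j. j \<in> tasks G \<Longrightarrow> start S j \<ge> t \<Longrightarrow> start S' j = t \<or> t + K < start S' j"
    "{j \<in> tasks G. start S' j = t} = scan_at A P G S' t"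
    "\<And>t2. t < t2 \<Longrightarrow> t2 \<le> t + K \<Longrightarrow> (\<And>j. j \<in> tasks G \<Longrightarrow> start S' j \<le> t \<Longrightarrow> completion G S' j \<le> t \<or> t2 \<le> completion G S' j)
       \<Longrightarrow> produces_before A P G S' t2"
    using produces_before_step[OF alg P G S t t0, of K] by blast
  have cp: "completion G S j = completion G S' j" if "start S j < t" for j
    using that S' by (simp add: completion_def)
  have late: "t < completion G S j" "t < completion G S' j" if "j \<in> tasks G" "t \<le> start S j" for j
  proof -
    have "0 \<le> K" using K[OF that(1)] pos[OF that(1)] by linarith
    then show "t < completion G S j" "t < completion G S' j"
      using pos[OF that(1)] that(2) S'(1) S'(3)[OF that] by (auto simp: completion_def)
  qed
  have same: "{j \<in> tasks G. t < completion G S' j} = {j \<in> tasks G. t < completion G S j}"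
  proof -
    have "t < completion G S' j \<longleftrightarrow> t < completion G S j" if "j \<in> tasks G" for j
      using cp[of j] late[OF that] by (cases "start S j < t") auto
    then show ?thesis by blast
  qed
  define N where "N = {j \<in> tasks G. start S' j \<le> t \<and> t < completion G S' j}"
  have finN: "finite N" using fin by (simp add: N_def)
  show ?case
  proof (cases "N = {}")
    case False
    define t2 where "t2 = Min (completion G S' ` N)"
    have "t2 \<in> completion G S' ` N" using False finN by (simp add: t2_def)
    then obtain i where i: "i \<in> N" "t2 = completion G S' i" by auto
    have le: "t2 \<le> completion G S' j" if "j \<in> N" for j
      using that finN by (simp add: t2_def)
    have "t < t2" using i by (simp add: N_def)
    moreover have "t2 \<le> t + K" using i K[of i] S'(1) by (auto simp: N_def completion_def)
    moreover have "completion G S' j \<le> t \<or> t2 \<le> completion G S' j"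
      if "j \<in> tasks G" "start S' j \<le> t" for j
      using le that by (force simp: N_def)
    ultimately have "produces_before A P G S' t2" using S'(5) by blast
    moreover have "t2 \<in> decision_times G S'" using i by (auto simp: decision_times_def N_def)
    moreover have "{j \<in> tasks G. t2 < completion G S' j} \<subset> {j \<in> tasks G. t < completion G S' j}"
      using i \<open>t < t2\<close> by (auto simp: N_def)
    then have "card {j \<in> tasks G. t2 < completion G S' j} < card {j \<in> tasks G. t < completion G S j}"
      unfolding same by (rule psubset_card_mono[rotated]) (use fin in simp)
    ultimately show ?thesis using less.hyps \<open>t < t2\<close> t0 by fastforce
  next
    case True
    have dec: "t \<in> decision_times G S'"
    proof -
      have "\<exists>j\<in>tasks G. t = completion G S' j" if "j \<in> tasks G" "t = completion G S j" for j
        using that cp[of j] late(1)[of j] by (cases "start S j < t") auto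
      then show ?thesis using t by (auto simp: decision_times_def)
    qed
    \<comment> \<open>Otherwise an unstarted task without unstarted predecessors is pending while
      all \<open>P\<close> processors are idle, and the head of the scan order, whichever task it
      is, fits and starts at \<open>t\<close>, so that \<open>N\<close> is not empty.\<close>
    have started: "start S' j \<le> t" if j: "j \<in> tasks G" for j
    proof (rule ccontr)
      assume nd: "\<not> start S' j \<le> t"
      have "wf (edges G)"
        using ac fin sub by (meson finite_SigmaI finite_acyclic_wf finite_subset)
      then obtain i where i: "i \<in> {j \<in> tasks G. \<not> start S' j \<le> t}"
        and mn: "\<And>k. (k, i) \<in> edges G \<Longrightarrow> k \<notin> {j \<in> tasks G. \<not> start S' j \<le> t}"
        using j nd wfE_min[of "edges G" j "{j \<in> tasks G. \<not> start S' j \<le> t}"] by blast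
      have "completion G S' k \<le> t" if "(k, i) \<in> edges G" for k
        using mn[OF that] that sub True by (force simp: N_def)
      then have "i \<in> revealed G S' t" using i by (auto simp: revealed_def)
      then have "i \<in> set (scan_order A P (view_at G S' t))"
        using i scan_order_props(2)[OF alg P G] by auto
      then obtain k ks where ks: "scan_order A P (view_at G S' t) = k # ks"
        by (metis list.set_cases)
      then have "k \<in> tasks G"
        using scan_order_props(2)[OF alg P G, of S' t] revealed_subset[of G S' t] by auto
      then have "procs S' k \<le> P" using pR S'(1) by auto
      moreover have "{j \<in> tasks G. start S' j < t \<and> t < completion G S' j} = {}"
        using True by (auto simp: N_def)
      then have "idle_procs P G S' t = P" by (simp only: idle_procs_def sum.empty)
      ultimately have "k \<in> scan_at A P G S' t" by (simp add: scan_at_def ks)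
      then have "k \<in> tasks G" "start S' k = t" using S'(4) by blast+
      then have "k \<in> N" using S'(1) pos[of k] by (auto simp: N_def completion_def)
      then show False using True by simp
    qed
    then have fin': "completion G S' j \<le> t" if "j \<in> tasks G" for j
      using that True by (force simp: N_def)
    have all: "t' \<le> t" if "t' \<in> decision_times G S'" for t'
      using that fin' t0 by (auto simp: decision_times_def)
    have run: "start S' j < t" if "j \<in> tasks G" for j
      using fin'[OF that] pos[OF that] S'(1) by (auto simp: completion_def)
    have emp: "scan_at A P G S' t = {}" using S'(4) run by fastforce
    \<comment> \<open>A placeholder of \<open>S\<close> would start in \<open>S'\<close> at
      \<open>t\<close> or later; so \<open>S\<close> was already final.\<close>
    have keep: "start S j < t" if "j \<in> tasks G" for j
      using run[OF that] S'(3)[OF that] K[OF that] pos[OF that] by fastforce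
    have ss: "start S' j = start S j" "completion G S' j = completion G S j" if "j \<in> tasks G" for j
      using keep[OF that] S'(2) cp by auto
    have decS: "decision_times G S' = decision_times G S"
      using ss by (auto simp: decision_times_def)
    have sc: "scan_at A P G S' t' = scan_at A P G S t'" for t'
    proof -
      have "agree_before G t' S S'" using ss S'(1) by (simp add: agree_before_def)
      from agree_before_decisions[OF this sub pos] show ?thesis
        using S'(1) by (simp add: scan_at_def)
    qed
    have "produces A P G S'"
      unfolding produces_def scan_at_def[symmetric]
    proof (intro conjI ballI)
      fix j assume j: "j \<in> tasks G"
      show "procs S' j = alloc A P (speedup_of G j)" by (simp add: S'(1) pr)
      show "start S' j \<in> decision_times G S'"
        using S j keep[OF j] ss[OF j] decS by (simp add: produces_before_def)
    next
      fix t' assume t': "t' \<in> decision_times G S'"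
      show "{j \<in> tasks G. start S' j = t'} = scan_at A P G S' t'"
      proof (cases "t' = t")
        case False
        then have "{j \<in> tasks G. start S j = t'} = scan_at A P G S t'"
          using S t' all[OF t'] decS by (simp add: produces_before_def)
        moreover have "{j \<in> tasks G. start S' j = t'} = {j \<in> tasks G. start S j = t'}"
          using ss by auto
        ultimately show ?thesis using sc by simp
      qed (use S'(4) in simp)
    qed
    then show ?thesis ..
  qed
qed

lemma produces_exists:
  assumes "online_list_algorithm M A" "P \<ge> 1" "task_graph_of_model M P G"
  shows "\<exists>S. produces A P G S"
proof (rule produces_before_extend[OF assms])
  let ?S = "\<lparr>start = \<lambda>_. 0, procs = \<lambda>j. alloc A P (speedup_of G j)\<rparr>"
  have "0 < completion G ?S j" if "j \<in> tasks G" for j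
    using exec_time_pos[OF assms(3) that] alloc_range[OF assms(1,2)] assms(3) that
    by (auto simp: completion_def task_graph_of_model_def)
  then show "produces_before A P G ?S 0"
    by (auto simp: produces_before_def decision_times_def dest: less_asym)
qed (simp_all add: decision_times_def)


section \<open>Competitive ratios\<close>

text \<open>Comparison with each single feasible schedule replaces the infimum: an adversary has to
  exhibit only one.\<close>

definition guarantees :: "model \<Rightarrow> algorithm \<Rightarrow> real \<Rightarrow> bool" where
  "guarantees M A r \<longleftrightarrow> (\<forall>P\<ge>1. \<forall>G S S'. task_graph_of_model M P G \<longrightarrow> produces A P G S \<longrightarrow>
     feasible P G S' \<longrightarrow> makespan G S \<le> r * makespan G S')"

lemma makespan_nonneg: "finite (tasks G) \<Longrightarrow> 0 \<le> makespan G S"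
  by (simp add: makespan_def)

lemma completion_le_makespan: "finite (tasks G) \<Longrightarrow> j \<in> tasks G \<Longrightarrow> completion G S j \<le> makespan G S"
  by (simp add: makespan_def)

lemma makespan_le:
  "finite (tasks G) \<Longrightarrow> 0 \<le> T \<Longrightarrow> (\<And>j. j \<in> tasks G \<Longrightarrow> completion G S j \<le> T) \<Longrightarrow> makespan G S \<le> T"
  by (simp add: makespan_def)

text \<open>The infimum is at most each feasible makespan, and it is nonnegative, so the ratio may
  also be enlarged; this later allows assuming \<open>2 \<le> r\<close>.\<close>

lemma competitive_guarantees:
  assumes comp: "competitive M A \<rho>" and r: "\<rho> \<le> r" "0 \<le> r"
  shows "guarantees M A r"
  unfolding guarantees_def
proof (intro allI impI)
  fix P :: nat and G S S'
  assume P: "P \<ge> 1" and G: "task_graph_of_model M P G" and S: "produces A P G S" and S': "feasible P G S'"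
  have fin: "finite (tasks G)" using G by (simp add: task_graph_of_model_def)
  let ?T = "{makespan G S |S. feasible P G S}"
  have "bdd_below ?T" by (rule bdd_belowI[of _ 0]) (use makespan_nonneg[OF fin] in auto)
  then have le: "opt_makespan P G \<le> makespan G S'"
    unfolding opt_makespan_def using S' by (intro cInf_lower) auto
  have nn: "0 \<le> opt_makespan P G"
    unfolding opt_makespan_def using S' makespan_nonneg[OF fin] by (intro cInf_greatest) auto
  have "makespan G S \<le> \<rho> * opt_makespan P G"
    using comp P G S by (simp add: competitive_def)
  also have "\<dots> \<le> r * opt_makespan P G" using r nn by (intro mult_right_mono) auto
  also have "\<dots> \<le> r * makespan G S'" using r le by (intro mult_left_mono) auto
  finally show "makespan G S \<le> r * makespan G S'" .
qed

section \<open>Precedence and capacity in the schedule of an algorithm\<close>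

locale produced =
  fixes M A P G S
  assumes alg: "online_list_algorithm M A" and P: "P \<ge> 1" and G: "task_graph_of_model M P G"
    and S: "produces A P G S"
begin

lemma fin: "finite (tasks G)"
  using G by (simp add: task_graph_of_model_def)

lemma procs_eq: "j \<in> tasks G \<Longrightarrow> procs S j = alloc A P (speedup_of G j)"
  using S by (simp add: produces_def)

lemma procs_range: "j \<in> tasks G \<Longrightarrow> procs S j \<in> {1..P}"
  using alloc_range[OF alg P] G by (simp add: procs_eq task_graph_of_model_def)

lemma start_less_completion: "j \<in> tasks G \<Longrightarrow> start S j < completion G S j"
  using exec_time_pos[OF G _ procs_range] by (simp add: completion_def)

lemma start_dec: "j \<in> tasks G \<Longrightarrow> start S j \<in> decision_times G S"
  using S by (simp add: produces_def)

lemma started_at: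
  "t \<in> decision_times G S \<Longrightarrow> {j \<in> tasks G. start S j = t} =
     scan (procs S) (idle_procs P G S t) (scan_order A P (view_at G S t))"
  using S by (simp add: produces_def)

lemmas order = scan_order_props[OF alg P G]

lemma start_revealed: "j \<in> tasks G \<Longrightarrow> j \<in> revealed G S (start S j)"
  using started_at[OF start_dec, of j] scan_subset order(2) by blast

lemma start_after_pred: "(i, j) \<in> edges G \<Longrightarrow> completion G S i \<le> start S j"
  using start_revealed[of j] G by (auto simp: revealed_def task_graph_of_model_def)

lemma procs_le_idle: "j \<in> tasks G \<Longrightarrow> procs S j \<le> idle_procs P G S (start S j)"
  using started_at[OF start_dec, of j] scan_mem_le by fastforce

text \<open>Decision times are completions or 0. If the earliest start were negative, it would be
  the completion of a task that started even earlier.\<close>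

lemma start_nonneg:
  assumes j: "j \<in> tasks G"
  shows "0 \<le> start S j"
proof (rule ccontr)
  assume neg: "\<not> 0 \<le> start S j"
  define i where "i = arg_min_on (start S) (tasks G)"
  have i: "i \<in> tasks G" "\<And>k. k \<in> tasks G \<Longrightarrow> start S i \<le> start S k"
    using arg_min_if_finite[of "tasks G" "start S"] j fin by (auto simp: i_def not_less[symmetric])
  have "start S i \<noteq> 0" using neg i(2)[OF j] by auto
  then obtain k where k: "k \<in> tasks G" "start S i = completion G S k"
    using start_dec[OF i(1)] by (auto simp: decision_times_def)
  then show False using i(2)[OF k(1)] start_less_completion[OF k(1)] by simp
qed

text \<open>Usage grows only when tasks start. All tasks running at \<open>t\<close> also run at
  \<open>u\<close>, the last of their start times, and the scan at \<open>u\<close> hands out idle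
  processors only.\<close>

lemma usage_le: "(\<Sum>j | j \<in> tasks G \<and> start S j \<le> t \<and> t < completion G S j. procs S j) \<le> P"
proof -
  define R where "R = {j \<in> tasks G. start S j \<le> t \<and> t < completion G S j}"
  have finR: "finite R" using fin by (simp add: R_def)
  show ?thesis
  proof (cases "R = {}")
    case False
    define u where "u = Max (start S ` R)"
    have "u \<in> start S ` R" using finR False by (simp add: u_def)
    then obtain i where i: "i \<in> R" "u = start S i" by auto
    have le: "start S j \<le> u" if "j \<in> R" for j using that finR by (simp add: u_def)
    have iG: "i \<in> tasks G" using i by (simp add: R_def)
    let ?B = "{j \<in> tasks G. start S j < u \<and> u < completion G S j}"
    let ?N = "{j \<in> tasks G. start S j = u}"
    \<comment> \<open>Positivity shows that the subtraction in \<open>idle_procs\<close> is not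
      truncated, as needed for the sum \<open>P\<close> below.\<close>
    have idle: "1 \<le> idle_procs P G S u"
      using procs_le_idle[OF iG] procs_range[OF iG] i by auto
    have "sum (procs S) R \<le> sum (procs S) (?B \<union> ?N)"
      using fin le i by (intro sum_mono2) (force simp: R_def)+
    also have "\<dots> = sum (procs S) ?B + sum (procs S) ?N"
      using fin by (intro sum.union_disjoint) auto
    also have "sum (procs S) ?N \<le> idle_procs P G S u"
      using started_at[of u] scan_sum_le[OF order(1)] start_dec[OF iG] i by simp
    also have "sum (procs S) ?B + idle_procs P G S u = P"
      using idle by (simp add: idle_procs_def)
    finally show ?thesis by (simp add: R_def)
  next
    case True
    then show ?thesis by (simp only: R_def sum.empty)
  qed
qed

text \<open>On an empty machine a pending set that fits as a whole is started completely, whatever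
  the scan order.\<close>

lemma started_all:
  assumes t: "t \<in> decision_times G S" and idle: "\<And>j. j \<in> tasks G \<Longrightarrow> start S j < t \<Longrightarrow> completion G S j \<le> t"
    and X: "{j \<in> revealed G S t. t \<le> start S j} = X" and le: "sum (procs S) X \<le> P" and j: "j \<in> X"
  shows "start S j = t"
proof -
  have none: "{j \<in> tasks G. start S j < t \<and> t < completion G S j} = {}"
    using idle by fastforce
  then have idle: "idle_procs P G S t = P" by (simp only: idle_procs_def sum.empty)
  have "sum_list (map (procs S) (scan_order A P (view_at G S t))) = sum (procs S) X"
    using order X by (simp add: sum_list_distinct_conv_sum_set)
  then have "{j \<in> tasks G. start S j = t} = X"
    using started_at[OF t] idle le order(2) X by (simp add: scan_all)
  then show ?thesis using j by blast
qed

end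

lemma guarantees_produced:
  assumes "online_list_algorithm M A" "guarantees M A r" "P \<ge> 1" "task_graph_of_model M P G"
    and "feasible P G S'"
  obtains S where "produced M A P G S" "makespan G S \<le> r * makespan G S'"
  using produces_exists[OF assms(1,3,4)] assms by (auto simp: guarantees_def produced_def)

section \<open>Graphs without edges\<close>

text \<open>The offline schedule gives this perfectly parallel task all \<open>P\<close>
  processors.\<close>

lemma single_task_allocation:
  assumes alg: "online_list_algorithm M A" and r: "guarantees M A r" "P \<ge> 1" and s: "follows_model M P s"
    and ex: "\<And>p. p \<in> {1..P} \<Longrightarrow> exec_time s p = e / p"
  shows "real P \<le> r * real (alloc A P s)"
proof -
  let ?G = "\<lparr>tasks = {0}, edges = {}, speedup_of = \<lambda>_. s\<rparr>"
  let ?S' = "\<lparr>start = \<lambda>_. 0, procs = \<lambda>_. P\<rparr>"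
  have e: "0 < e" using s ex[of 1] r(2) by (auto simp: follows_model_def)
  have G: "task_graph_of_model M P ?G" by (simp add: task_graph_of_model_def s acyclic_def)
  have "feasible P ?G ?S'"
  proof -
    have "(\<Sum>j | j = (0::nat) \<and> 0 \<le> t \<and> t < completion ?G ?S' j. P) \<le> (\<Sum>j\<in>{0::nat}. P)" for t
      by (intro sum_mono2) auto
    then show ?thesis using r(2) by (simp add: feasible_def)
  qed
  from guarantees_produced[OF alg r G this] obtain S where
    S: "produced M A P ?G S" and le: "makespan ?G S \<le> r * makespan ?G ?S'" by blast
  interpret produced M A P ?G S by fact
  have p: "alloc A P s \<in> {1..P}" using alloc_range[OF alg r(2) s] .
  have "e / alloc A P s \<le> completion ?G S 0"
    using start_nonneg[of 0] procs_eq[of 0] ex[OF p] by (simp add: completion_def)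
  also have "\<dots> \<le> makespan ?G S" by (rule completion_le_makespan) auto
  also have "\<dots> \<le> r * (e / P)"
    using le e r(2) ex[of P] by (simp add: makespan_def completion_def)
  finally show ?thesis using e p r(2) by (simp add: field_simps)
qed

text \<open>An area argument on \<open>P\<close> copies of the task, each of which gets one
  processor offline. It bounds allocations from above; the \<open>- 1\<close> pays for rounding the
  makespan to multiples of the execution time.\<close>

lemma identical_tasks_allocation:
  assumes alg: "online_list_algorithm M A" and r: "guarantees M A r" "P \<ge> 1" and s: "follows_model M P s"
  shows "(real (alloc A P s) - 1) * exec_time s (alloc A P s) \<le> r * exec_time s 1"
proof -
  let ?G = "\<lparr>tasks = {..<P}, edges = {}, speedup_of = \<lambda>_. s\<rparr>"
  let ?S' = "\<lparr>start = \<lambda>_. 0, procs = \<lambda>_. 1\<rparr>"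
  have G: "task_graph_of_model M P ?G" by (simp add: task_graph_of_model_def s acyclic_def)
  have "feasible P ?G ?S'"
  proof -
    have "card {j. j < P \<and> 0 \<le> t \<and> t < completion ?G ?S' j} \<le> card {..<P}" for t
      by (intro card_mono) auto
    then show ?thesis using r(2) by (simp add: feasible_def)
  qed
  from guarantees_produced[OF alg r G this] obtain S where
    S: "produced M A P ?G S" and le: "makespan ?G S \<le> r * makespan ?G ?S'" by blast
  interpret produced M A P ?G S by fact
  define q where "q = alloc A P s"
  have q: "q \<in> {1..P}" using alloc_range[OF alg r(2) s] by (simp add: q_def)
  define \<tau> where "\<tau> = exec_time s q"
  have \<tau>: "0 < \<tau>" using s q by (simp add: \<tau>_def follows_model_def)
  have e: "0 < exec_time s 1" using s r(2) by (simp add: follows_model_def)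
  define T where "T = makespan ?G S"
  have c: "completion ?G S j = start S j + \<tau>" if "j < P" for j
    using that procs_eq[of j] by (simp add: completion_def \<tau>_def q_def)
  have cT: "start S j + \<tau> \<le> T" if "j < P" for j
    using that c completion_le_makespan[of ?G j S] by (simp add: T_def)
  \<comment> \<open>Every task runs at exactly one multiple of its execution time.\<close>
  define slot where "slot j = nat \<lceil>start S j / \<tau>\<rceil>" for j
  have slot: "start S j \<le> slot j * \<tau>" "slot j * \<tau> < start S j + \<tau>" if "j < P" for j
  proof -
    have "0 \<le> start S j / \<tau>" using start_nonneg[of j] that \<tau> by simp
    then have "start S j / \<tau> \<le> slot j" "slot j < start S j / \<tau> + 1"
      unfolding slot_def by linarith+
    then show "start S j \<le> slot j * \<tau>" "slot j * \<tau> < start S j + \<tau>"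
      using \<tau> by (simp_all add: field_simps)
  qed
  define K where "K = nat \<lceil>T / \<tau>\<rceil>"
  have "0 \<le> T" unfolding T_def by (rule makespan_nonneg) simp
  have img: "slot ` {..<P} \<subseteq> {..<K}"
  proof clarify
    fix j assume "j < P"
    then have "slot j * \<tau> < T" using slot(2) cT by fastforce
    then have "slot j < T / \<tau>" using \<tau> by (simp add: field_simps)
    then show "slot j < K" unfolding K_def by linarith
  qed
  \<comment> \<open>\<open>P\<close> tasks of \<open>q\<close> processors are spread over
    \<open>K\<close> slots of capacity \<open>P\<close>, whence \<open>q \<le> K\<close>.\<close>
  have "P * q = (\<Sum>j<P. q)" by simp
  also have "\<dots> = (\<Sum>k<K. \<Sum>j\<in>{j \<in> {..<P}. slot j = k}. q)"
    using img by (intro sum.group[symmetric]) auto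
  also have "\<dots> \<le> (\<Sum>k<K. P)"
  proof (rule sum_mono)
    fix k
    have "(\<Sum>j\<in>{j \<in> {..<P}. slot j = k}. q) = (\<Sum>j\<in>{j \<in> {..<P}. slot j = k}. procs S j)"
      using procs_eq by (intro sum.cong) (auto simp: q_def)
    also have "\<dots> \<le> (\<Sum>j | j \<in> tasks ?G \<and> start S j \<le> k * \<tau> \<and> k * \<tau> < completion ?G S j. procs S j)"
      using slot c by (intro sum_mono2) auto
    also have "\<dots> \<le> P" by (rule usage_le)
    finally show "(\<Sum>j\<in>{j \<in> {..<P}. slot j = k}. q) \<le> P" .
  qed
  finally have "q \<le> K" using r(2) by simp
  moreover have "0 \<le> T / \<tau>" using \<open>0 \<le> T\<close> \<tau> by simp
  ultimately have "real q < T / \<tau> + 1" unfolding K_def by linarith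
  then have area: "(real q - 1) * \<tau> \<le> T" using \<tau> by (simp add: field_simps)
  have "makespan ?G ?S' = exec_time s 1"
  proof (rule antisym)
    show "makespan ?G ?S' \<le> exec_time s 1"
      using e by (intro makespan_le) (auto simp: completion_def)
    show "exec_time s 1 \<le> makespan ?G ?S'"
      using completion_le_makespan[of ?G 0 ?S'] r(2) by (simp add: completion_def)
  qed
  then have "T \<le> r * exec_time s 1" using le by (simp add: T_def)
  with area have "(real q - 1) * \<tau> \<le> r * exec_time s 1" by simp
  then show ?thesis by (simp add: q_def \<tau>_def)
qed


section \<open>A chain of blocking stages\<close>

text \<open>Stage \<open>k < nB\<close> consists of a short task of kind \<open>Y\<close>, of \<open>m\<close> tasks of kind \<open>B\<close>, and of a
  task of kind \<open>X\<close> that needs the \<open>Y\<close> task; it is followed by \<open>nC\<close> stages made of a single task of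
  kind \<open>C\<close>. All tasks of a stage need the task \<open>X\<close> or \<open>C\<close> of the preceding stage. Task
  \<open>k * (m + 2) + l\<close> is the \<open>l\<close>-th task of stage \<open>k\<close>, where \<open>l = 0\<close> stands for \<open>X\<close> or \<open>C\<close>, and
  \<open>l = 1\<close> for \<open>Y\<close>. List scheduling starts \<open>Y\<close> and all \<open>B\<close> first, and then \<open>X\<close> has to wait for
  the \<open>B\<close>, whereas an optimal schedule postpones all the \<open>B\<close>.\<close>

locale stages =
  fixes M :: model and P m nB nC :: nat and X Y B C :: speedup
  assumes P: "P \<ge> 1"
    and XYBC: "follows_model M P X" "follows_model M P Y" "follows_model M P B" "follows_model M P C"
begin

definition stage :: "nat \<Rightarrow> nat" where "stage j = j div (m + 2)"
definition role :: "nat \<Rightarrow> nat" where "role j = j mod (m + 2)"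
definition node :: "nat \<Rightarrow> nat \<Rightarrow> nat" where "node k l = k * (m + 2) + l"

lemma stage_node [simp]: "l < m + 2 \<Longrightarrow> stage (node k l) = k"
  by (simp add: stage_def node_def del: add_2_eq_Suc' mult_Suc_right)

lemma role_node [simp]: "l < m + 2 \<Longrightarrow> role (node k l) = l"
  by (simp add: role_def node_def del: add_2_eq_Suc' mult_Suc_right)

lemma node_stage_role [simp]: "node (stage j) (role j) = j"
  by (simp only: stage_def role_def node_def div_mult_mod_eq)

lemma role_less: "role j < m + 2"
  by (simp add: role_def)

lemma node_eq_iff: "stage i = stage j \<Longrightarrow> role i = role j \<Longrightarrow> i = j"
  by (metis node_stage_role)

definition vertices :: "nat set" where
  "vertices = {j. stage j < nB \<or> stage j < nB + nC \<and> role j = 0}"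

definition graph :: task_graph where
  "graph = \<lparr>tasks = vertices,
     edges = {(i, j). i \<in> vertices \<and> j \<in> vertices \<and>
       (role i = 0 \<and> stage j = Suc (stage i) \<or> role i = 1 \<and> role j = 0 \<and> stage j = stage i)},
     speedup_of = (\<lambda>j. if role j = 0 then if stage j < nB then X else C
        else if role j = 1 then Y else B)\<rparr>"

lemma finite_vertices: "finite vertices"
proof (rule finite_subset)
  show "vertices \<subseteq> (\<lambda>(k, l). node k l) ` ({..<nB + nC} \<times> {..<m + 2})"
  proof
    fix j assume "j \<in> vertices"
    then have "(stage j, role j) \<in> {..<nB + nC} \<times> {..<m + 2}"
      using role_less by (auto simp: vertices_def)
    then show "j \<in> (\<lambda>(k, l). node k l) ` ({..<nB + nC} \<times> {..<m + 2})"
      by (metis (no_types, lifting) case_prod_conv image_eqI node_stage_role)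
  qed
qed simp

lemma graph_model: "task_graph_of_model M P graph"
proof -
  \<comment> \<open>The summand 1 handles the edge from \<open>Y\<close> to \<open>X\<close> within
    a stage; edges into the next stage still increase the measure.\<close>
  have "edges graph \<subseteq> measure (\<lambda>j. 2 * stage j + (if role j = 0 then 1 else 0))"
    by (auto simp: graph_def)
  then have "acyclic (edges graph)"
    by (rule acyclic_subset[OF wf_acyclic[OF wf_measure]])
  then show ?thesis
    using XYBC finite_vertices by (auto simp: task_graph_of_model_def graph_def)
qed

end

section \<open>The schedule of the algorithm on the stages\<close>

locale produced_stages = stages + produced M A P "stages.graph m nB nC X Y B C" S
  for A S +
  assumes fit: "m * alloc A P B + alloc A P Y \<le> P"
    and block: "P < m * alloc A P B + alloc A P X"
begin

abbreviation "tB \<equiv> exec_time B (alloc A P B)"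
abbreviation "tC \<equiv> exec_time C (alloc A P C)"

lemma speedup [simp]: "speedup_of graph j = (if role j = 0 then if stage j < nB then X else C
        else if role j = 1 then Y else B)"
  by (simp add: graph_def)

lemma tasks [simp]: "tasks graph = vertices"
  by (simp add: graph_def)

lemma head_vertex: "k < nB + nC \<Longrightarrow> node k 0 \<in> vertices"
  by (simp add: vertices_def)

lemma start_after_stage:
  assumes "j \<in> vertices" "stage j = Suc k"
  shows "completion graph S (node k 0) \<le> start S j"
  using assms by (intro start_after_pred) (auto simp: graph_def vertices_def)

definition begin_stage :: "nat \<Rightarrow> real" where
  "begin_stage k = (case k of 0 \<Rightarrow> 0 | Suc i \<Rightarrow> completion graph S (node i 0))"

lemma start_ge_begin_stage: "j \<in> vertices \<Longrightarrow> begin_stage (stage j) \<le> start S j"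
  using start_after_stage[of j] start_nonneg[of j]
  by (cases "stage j") (auto simp: begin_stage_def)

lemma begin_stage_strict:
  assumes "k < nB + nC" shows "begin_stage k < begin_stage (Suc k)"
  using start_ge_begin_stage[OF head_vertex[OF assms]] start_less_completion[of "node k 0"] head_vertex[OF assms]
  by (simp add: begin_stage_def)

lemma begin_stage_mono: "i \<le> k \<Longrightarrow> k \<le> nB + nC \<Longrightarrow> begin_stage i \<le> begin_stage k"
proof (induction k rule: dec_induct)
  case (step k)
  then show ?case using begin_stage_strict[of k] by simp
qed simp

lemma begin_stage_dec: "k \<le> nB + nC \<Longrightarrow> begin_stage k \<in> decision_times graph S"
  using head_vertex by (auto simp: begin_stage_def decision_times_def split: nat.split)

text \<open>By \<open>prev\<close> the machine is empty when the stage begins, so \<open>fit\<close>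
  makes \<open>Y\<close> and all \<open>B\<close> start at once. \<open>X\<close> becomes available
  only after \<open>Y\<close>, and \<open>block\<close> keeps it waiting until the \<open>B\<close>
  end, all at the same time. The second claim provides \<open>prev\<close> for the next
  stage.\<close>

lemma blocking_stage:
  assumes k: "k < nB"
    and prev: "\<And>j. j \<in> vertices \<Longrightarrow> stage j < k \<Longrightarrow> completion graph S j \<le> begin_stage k"
  shows "begin_stage k + tB \<le> begin_stage (Suc k)"
    and "\<And>j. j \<in> vertices \<Longrightarrow> stage j = k \<Longrightarrow> completion graph S j \<le> begin_stage (Suc k)"
proof -
  define t where "t = begin_stage k"
  \<comment> \<open>The tasks \<open>Y\<close> and \<open>B\<close> of the stage: exactly what is
    pending at \<open>t\<close>.\<close>
  define F where "F = node k ` {1..<m + 2}"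
  have kv: "node k l \<in> vertices" if "l < m + 2" for l
    using that k by (simp add: vertices_def)
  have tdec: "t \<in> decision_times graph S" unfolding t_def using k by (intro begin_stage_dec) simp
  have prev': "stage j \<ge> k" if "j \<in> vertices" "t \<le> start S j" for j
    using prev[OF that(1)] start_less_completion[of j] that by (fastforce simp: t_def)
  have next': "t \<le> start S i" "t < completion graph S i" if "i \<in> vertices" "stage i \<ge> k" for i
  proof -
    have "t \<le> begin_stage (stage i)"
      unfolding t_def using that by (intro begin_stage_mono) (auto simp: vertices_def)
    then show "t \<le> start S i" "t < completion graph S i"
      using start_ge_begin_stage[OF that(1)] start_less_completion[of i] that(1) by auto
  qed
  have Y_X: "(node k 1, node k 0) \<in> edges graph"
    using kv by (simp add: graph_def)
  have F: "{j \<in> revealed graph S t. t \<le> start S j} = F"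
  proof (intro equalityI subsetI)
    fix j assume "j \<in> {j \<in> revealed graph S t. t \<le> start S j}"
    then have j: "j \<in> vertices" "t \<le> start S j" and rv: "\<And>i. (i, j) \<in> edges graph \<Longrightarrow> completion graph S i \<le> t"
      by (auto simp: revealed_def)
    have "stage j = k"
    proof (rule ccontr)
      assume "stage j \<noteq> k"
      then obtain i where i: "stage j = Suc i" "k \<le> i"
        using prev'[OF j] by (cases "stage j") auto
      then have "node i 0 \<in> vertices" "(node i 0, j) \<in> edges graph"
        using j by (auto simp: graph_def vertices_def)
      then show False using rv next'(2)[of "node i 0"] i by fastforce
    qed
    moreover have "role j \<noteq> 0"
    proof
      assume "role j = 0"
      then have "j = node k 0" using \<open>stage j = k\<close> by (metis node_stage_role)
      then show False using rv Y_X next'(2)[of "node k 1"] kv[of 1] by fastforce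
    qed
    ultimately show "j \<in> F"
      unfolding F_def using role_less[of j] node_stage_role[of j] by (metis One_nat_def Suc_leI atLeastLessThan_iff gr0I image_eqI)
  next
    fix j assume "j \<in> F"
    then obtain l where l: "j = node k l" "1 \<le> l" "l < m + 2" by (auto simp: F_def)
    have jv: "j \<in> vertices" using kv l by simp
    have "completion graph S i \<le> t" if "(i, j) \<in> edges graph" for i
    proof -
      have i: "i \<in> vertices" "role i = 0" "k = Suc (stage i)"
        using that l by (auto simp: graph_def)
      then have "i = node (stage i) 0" by (metis node_stage_role)
      then show ?thesis using i by (auto simp: t_def begin_stage_def)
    qed
    then show "j \<in> {j \<in> revealed graph S t. t \<le> start S j}"
      using jv start_ge_begin_stage[OF jv] l by (auto simp: revealed_def t_def)
  qed
  have B: "alloc A P (speedup_of graph (node k l)) = alloc A P B" if "l \<in> {2..<m+2}" for l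
    using that by auto
  have inj: "inj_on (node k) D" for D by (simp add: inj_on_def node_def)
  have "sum (procs S) F = (\<Sum>l\<in>{1..<m + 2}. alloc A P (speedup_of graph (node k l)))"
    unfolding F_def using kv by (subst sum.reindex[OF inj]) (auto simp: procs_eq intro!: sum.cong)
  also have "{1..<m + 2} = insert 1 {2..<m + 2}" by auto
  also have "(\<Sum>l\<in>insert 1 {2..<m + 2}. alloc A P (speedup_of graph (node k l))) = alloc A P Y + m * alloc A P B"
    using B by (subst sum.insert) (auto simp del: speedup simp add: speedup[of "node k (Suc 0)"])
  finally have le_P: "sum (procs S) F \<le> P" using fit by simp
  have start_F: "start S j = t" if "j \<in> F" for j
  proof (rule started_all[OF tdec _ F le_P that])
    fix i assume "i \<in> tasks graph" "start S i < t"
    then show "completion graph S i \<le> t"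
      using prev[of i] next'(1)[of i] by (fastforce simp: t_def)
  qed
  have compl_B: "completion graph S (node k l) = t + tB" if "l \<in> {2..<m + 2}" for l
  proof -
    have "node k l \<in> F" using that by (simp add: F_def)
    then show ?thesis using B[OF that] start_F kv that by (simp add: completion_def procs_eq)
  qed
  have X: "t + tB \<le> start S (node k 0)"
  proof (rule ccontr)
    assume early: "\<not> t + tB \<le> start S (node k 0)"
    \<comment> \<open>Strictness matters, since \<open>idle_procs\<close> subtracts only tasks that
      started strictly earlier.\<close>
    have "t < start S (node k 0)"
      using start_after_pred[OF Y_X] next'(2)[of "node k 1"] kv[of 1] by simp
    then have "node k ` {2..<m + 2} \<subseteq>
       {j \<in> tasks graph. start S j < start S (node k 0) \<and> start S (node k 0) < completion graph S j}"
      using early compl_B start_F kv by (auto simp: F_def)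
    then have "sum (procs S) (node k ` {2..<m + 2}) \<le>
       (\<Sum>j\<in>{j \<in> tasks graph. start S j < start S (node k 0) \<and> start S (node k 0) < completion graph S j}. procs S j)"
      using finite_vertices by (intro sum_mono2) auto
    moreover have "sum (procs S) (node k ` {2..<m + 2}) = m * alloc A P B"
      using kv B by (subst sum.reindex[OF inj]) (simp add: procs_eq)
    ultimately have "idle_procs P graph S (start S (node k 0)) \<le> P - m * alloc A P B"
      by (simp add: idle_procs_def)
    then have "alloc A P X \<le> P - m * alloc A P B"
      using procs_le_idle[of "node k 0"] kv[of 0] k by (simp add: procs_eq)
    then show False using block fit by simp
  qed
  then show fin_B: "begin_stage k + tB \<le> begin_stage (Suc k)"
    using start_less_completion[of "node k 0"] kv[of 0] by (simp add: begin_stage_def t_def)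
  fix j assume j: "j \<in> vertices" "stage j = k"
  consider "role j = 0" | "role j = 1" | "role j \<in> {2..<m+2}"
    using role_less[of j] by fastforce
  then show "completion graph S j \<le> begin_stage (Suc k)"
  proof cases
    case 1
    then have "j = node k 0" using j by (metis node_stage_role)
    then show ?thesis by (simp add: begin_stage_def)
  next
    case 2
    then have "j = node k 1" using j by (metis node_stage_role)
    then show ?thesis
      using start_after_pred[OF Y_X] start_less_completion[of "node k 0"] kv[of 0]
      by (simp add: begin_stage_def)
  next
    case 3
    then have "completion graph S j = t + tB" using compl_B j by (metis node_stage_role)
    then show ?thesis using fin_B by (simp add: t_def)
  qed
qed

text \<open>The second conjunct carries the hypothesis \<open>prev\<close> of
  \<open>blocking_stage\<close> through the induction. The truncated \<open>k - nB\<close> counts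
  the chain stages passed so far.\<close>

lemma begin_stage_ge:
  "k \<le> nB + nC \<Longrightarrow> real (min k nB) * tB + real (k - nB) * tC \<le> begin_stage k \<and>
     (\<forall>j\<in>vertices. stage j < k \<longrightarrow> completion graph S j \<le> begin_stage k)"
proof (induction k)
  case 0
  then show ?case by (simp add: begin_stage_def)
next
  case (Suc k)
  then have IH: "real (min k nB) * tB + real (k - nB) * tC \<le> begin_stage k"
    "\<And>j. j \<in> vertices \<Longrightarrow> stage j < k \<Longrightarrow> completion graph S j \<le> begin_stage k" by auto
  have le: "begin_stage k \<le> begin_stage (Suc k)"
    using Suc.prems by (intro begin_stage_mono) auto
  show ?case
  proof (cases "k < nB")
    case True
    note bl = blocking_stage[OF True IH(2)]
    have "completion graph S j \<le> begin_stage (Suc k)" if "j \<in> vertices" "stage j < Suc k" for j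
      using that bl(2)[of j] IH(2)[of j] le by (cases "stage j = k") auto
    then show ?thesis using True IH(1) bl(1) by (simp add: min_def algebra_simps)
  next
    case False
    have "completion graph S j \<le> begin_stage (Suc k)" if "j \<in> vertices" "stage j < Suc k" for j
    proof (cases "stage j = k")
      case True
      then have "j = node k 0" using that False by (metis (mono_tags, lifting) mem_Collect_eq node_stage_role vertices_def)
      then show ?thesis by (simp add: begin_stage_def)
    qed (use that IH(2)[of j] le in auto)
    moreover have "begin_stage k + tC \<le> begin_stage (Suc k)"
      using start_ge_begin_stage[of "node k 0"] head_vertex[of k] False Suc.prems
      by (simp add: begin_stage_def completion_def procs_eq)
    ultimately show ?thesis using False IH(1) by (simp add: Suc_diff_le algebra_simps)
  qed
qed

lemma makespan_ge: "nB * tB + nC * tC \<le> makespan graph S"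
proof (cases "nB + nC")
  case 0
  then show ?thesis using makespan_nonneg[of graph S] fin by auto
next
  case (Suc k)
  then have "begin_stage (nB + nC) \<le> makespan graph S"
    using completion_le_makespan[of graph "node k 0" S] head_vertex[of k] finite_vertices
    by (simp add: begin_stage_def)
  then show ?thesis using begin_stage_ge[of "nB + nC"] by simp
qed

end


section \<open>A good offline schedule of the stages\<close>

locale offline_stages = stages +
  fixes h :: nat and e :: real
  assumes h: "1 \<le> h" "h < P" and m: "1 \<le> m"
    and eX: "exec_time X 1 = e" and eY: "exec_time Y 1 = e"
begin

text \<open>The tasks \<open>X\<close>, \<open>Y\<close> and \<open>C\<close> are executed one after the other, in the order of their
  positions; the tasks \<open>B\<close> fill up the slots of \<open>P - h\<close> processors once all of them are available.\<close>

definition position :: "nat \<Rightarrow> nat" where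
  "position j = (if role j = 1 then 2 * stage j else if stage j < nB then 2 * stage j + 1 else nB + stage j)"

text \<open>Positions below \<open>2 * nB\<close> belong to \<open>X\<close> and \<open>Y\<close>,
  which take \<open>e\<close> on one processor; the later ones belong to the chain, executed on
  \<open>h\<close> processors.\<close>

definition position_time :: "nat \<Rightarrow> real" where
  "position_time c = real (min c (2 * nB)) * e + real (c - 2 * nB) * exec_time C h"

text \<open>A gapless enumeration of the tasks \<open>B\<close>, whose roles start at 2;
  \<open>P - h\<close> consecutive indices share a slot.\<close>

definition index :: "nat \<Rightarrow> nat" where "index j = stage j * m + (role j - 2)"
definition slot :: "nat \<Rightarrow> nat" where "slot j = index j div (P - h)"

definition offline :: schedule where
  "offline = \<lparr>start = \<lambda>j. if role j < 2 then position_time (position j) else 2 * nB * e + slot j * exec_time B 1,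
     procs = \<lambda>j. if role j = 0 \<and> nB \<le> stage j then h else 1\<rparr>"

lemma positive: "0 < e" "0 < exec_time B 1" "0 < exec_time C h"
  using XYBC P h eX by (auto simp: follows_model_def)

lemma position_time_mono: "c \<le> d \<Longrightarrow> position_time c \<le> position_time d"
  using positive unfolding position_time_def by (intro add_mono mult_right_mono) auto

lemma completion_line:
  assumes "j \<in> vertices" "role j < 2"
  shows "completion graph offline j = position_time (Suc (position j))"
proof (cases "role j = 0 \<and> nB \<le> stage j")
  case True
  then show ?thesis
    by (simp add: completion_def offline_def graph_def position_def position_time_def
        Suc_diff_le algebra_simps)
next
  case False
  then have "stage j < nB" using assms by (auto simp: vertices_def)
  then have "position j < 2 * nB" using assms(2) by (auto simp: position_def)
  then have "position_time (Suc (position j)) = position_time (position j) + e"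
    by (simp add: position_time_def min_def algebra_simps)
  moreover have "role j = 0 \<or> role j = 1" using assms(2) by auto
  ultimately show ?thesis
    using False eX eY \<open>stage j < nB\<close> by (auto simp: completion_def offline_def graph_def)
qed

lemma completion_bulk:
  "2 \<le> role j \<Longrightarrow> completion graph offline j = 2 * nB * e + (real (slot j) + 1) * exec_time B 1"
  by (simp add: completion_def offline_def graph_def algebra_simps)

lemma bulk_stage: "j \<in> vertices \<Longrightarrow> 0 < role j \<Longrightarrow> stage j < nB"
  by (auto simp: vertices_def)

lemma position_inj:
  assumes "i \<in> vertices" "role i < 2" "j \<in> vertices" "role j < 2" "position i = position j"
  shows "i = j"
proof -
  have r: "role i = 0 \<or> role i = 1" "role j = 0 \<or> role j = 1" using assms by auto
  have "stage i = stage j \<and> role i = role j"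
    using r bulk_stage[OF assms(1)] bulk_stage[OF assms(3)] assms(5)
    by (auto simp: position_def split: if_splits) presburger+
  then show ?thesis using node_eq_iff by blast
qed

text \<open>At any time at most one task of the line \<open>N\<close> runs, on at most
  \<open>h\<close> processors, and the running \<open>B\<close> share one slot, so there are at most
  \<open>P - h\<close> of them.\<close>

lemma offline_usage:
  "(\<Sum>j | j \<in> tasks graph \<and> start offline j \<le> t \<and> t < completion graph offline j. procs offline j) \<le> P"
proof -
  define N where "N = {j \<in> vertices. role j < 2 \<and> start offline j \<le> t \<and> t < completion graph offline j}"
  define F where "F = {j \<in> vertices. 2 \<le> role j \<and> start offline j \<le> t \<and> t < completion graph offline j}"
  have fin: "finite N" "finite F" using finite_vertices by (simp_all add: N_def F_def)
  have "i = j" if "i \<in> N" "j \<in> N" for i j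
  proof -
    have ord: "position u \<le> position v" if "u \<in> N" "v \<in> N" for u v
    proof (rule ccontr)
      assume "\<not> position u \<le> position v"
      then have "completion graph offline v \<le> start offline u"
        using that completion_line[of v] position_time_mono[of "Suc (position v)" "position u"]
        by (auto simp: N_def offline_def)
      then show False using that by (auto simp: N_def)
    qed
    have "position i = position j" using ord that by (simp add: antisym)
    then show ?thesis using that position_inj by (auto simp: N_def)
  qed
  then have "card N \<le> 1" using fin by (simp add: card_le_Suc0_iff_eq)
  moreover have "sum (procs offline) N \<le> card N * h"
    using h by (intro sum_bounded_above[where 'a=nat, simplified]) (auto simp: offline_def)
  ultimately have N: "sum (procs offline) N \<le> h" by (metis le_trans mult_le_mono1 mult_1)
  have same: "slot i \<le> slot j" if "i \<in> F" "j \<in> F" for i j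
  proof (rule ccontr)
    assume "\<not> slot i \<le> slot j"
    then have "(real (slot j) + 1) * exec_time B 1 \<le> slot i * exec_time B 1"
      using positive by (intro mult_right_mono) auto
    then have "completion graph offline j \<le> start offline i"
      using that completion_bulk[of j] by (auto simp: F_def offline_def)
    then show False using that by (auto simp: F_def)
  qed
  have F: "card F \<le> P - h"
  proof (cases "F = {}")
    case False
    then obtain i where i: "i \<in> F" by blast
    have "inj_on index F"
    proof
      fix u v assume uv: "u \<in> F" "v \<in> F" "index u = index v"
      have sm: "index w div m = stage w" "index w mod m = role w - 2" if "w \<in> F" for w
      proof -
        have "role w - 2 < m" using that role_less[of w] by (auto simp: F_def)
        then obtain d where "role w - 2 = d" "d < m" by blast
        then show "index w div m = stage w" "index w mod m = role w - 2"
          by (simp_all add: index_def)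
      qed
      then have "stage u = stage v" "role u - 2 = role v - 2" using uv by metis+
      then show "u = v" using uv node_eq_iff[of u v] by (auto simp: F_def)
    qed
    moreover have "index ` F \<subseteq> {slot i * (P - h)..<slot i * (P - h) + (P - h)}"
    proof clarify
      fix j assume "j \<in> F"
      then have "index j div (P - h) = slot i" using same i by (metis antisym slot_def)
      then have "index j = slot i * (P - h) + index j mod (P - h)"
        by (metis div_mult_mod_eq)
      moreover have "index j mod (P - h) < P - h" using h by simp
      ultimately show "index j \<in> {slot i * (P - h)..<slot i * (P - h) + (P - h)}"
        by (metis atLeastLessThan_iff le_add1 nat_add_left_cancel_less)
    qed
    ultimately have "card F \<le> card {slot i * (P - h)..<slot i * (P - h) + (P - h)}"
      by (intro card_inj_on_le) auto
    then show ?thesis by simp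
  qed simp
  have "{j. j \<in> tasks graph \<and> start offline j \<le> t \<and> t < completion graph offline j} = N \<union> F"
    by (auto simp: N_def F_def graph_def)
  moreover have "sum (procs offline) (N \<union> F) = sum (procs offline) N + sum (procs offline) F"
    using fin by (intro sum.union_disjoint) (auto simp: N_def F_def)
  moreover have "sum (procs offline) F = card F"
    by (subst card_eq_sum, intro sum.cong) (auto simp: F_def offline_def)
  ultimately show ?thesis using N F h by simp
qed

lemma offline_feasible: "feasible P graph offline"
  unfolding feasible_def
proof (intro conjI ballI allI)
  fix j assume "j \<in> tasks graph"
  show "procs offline j \<in> {1..P}" using h by (auto simp: offline_def)
  show "0 \<le> start offline j" using positive by (auto simp: offline_def position_time_def)
next
  fix ij assume ij: "ij \<in> edges graph"
  obtain i j where eq: "ij = (i, j)" by force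
  have v: "i \<in> vertices" "j \<in> vertices" and ri: "role i < 2"
    and cs: "role i = 0 \<and> stage j = Suc (stage i) \<or> role i = 1 \<and> role j = 0 \<and> stage j = stage i"
    using ij eq by (auto simp: graph_def)
  have "completion graph offline i \<le> start offline j"
  proof (cases "role j < 2")
    case True
    then have "role j = 0 \<or> role j = 1" by auto
    then have "Suc (position i) \<le> position j"
      using cs bulk_stage[OF v(1)] bulk_stage[OF v(2)] by (auto simp: position_def)
    then show ?thesis
      using completion_line[OF v(1) ri] position_time_mono True by (simp add: offline_def)
  next
    case False
    then have "role i = 0" "stage j = Suc (stage i)" "stage j < nB" using cs bulk_stage[OF v(2)] by auto
    then have "position_time (Suc (position i)) \<le> position_time (2 * nB)"
      by (intro position_time_mono) (auto simp: position_def)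
    also have "\<dots> \<le> start offline j" using False positive by (simp add: position_time_def offline_def)
    finally show ?thesis using completion_line[OF v(1) ri] by simp
  qed
  then show "case ij of (i, j) \<Rightarrow> completion graph offline i \<le> start offline j" using eq by simp
qed (rule offline_usage)

text \<open>After all \<open>X\<close> and \<open>Y\<close>, the chain and the \<open>B\<close> run
  side by side, hence the maximum. The \<open>+ 1\<close> accounts for an incomplete last
  slot.\<close>

lemma offline_makespan:
  "makespan graph offline \<le>
     2 * nB * e + max (nC * exec_time C h) ((nB * m / (P - h) + 1) * exec_time B 1)" (is "_ \<le> ?D + ?T")
proof (rule makespan_le)
  show "finite (tasks graph)" using finite_vertices by (simp add: graph_def)
  show "0 \<le> ?D + ?T" using positive by (auto simp: max_def)
  fix j assume "j \<in> tasks graph"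
  then have j: "j \<in> vertices" by (simp add: graph_def)
  show "completion graph offline j \<le> ?D + ?T"
  proof (cases "role j < 2")
    case True
    have "position_time (Suc (position j)) \<le> position_time (2 * nB + nC)"
      using j by (intro position_time_mono) (auto simp: position_def vertices_def)
    then show ?thesis using completion_line[OF j True] by (simp add: position_time_def)
  next
    case False
    then have "stage j < nB" "role j - 2 < m" using bulk_stage[OF j] role_less[of j] by auto
    then have "index j < Suc (stage j) * m" by (simp add: index_def)
    also have "\<dots> \<le> nB * m" using \<open>stage j < nB\<close> by (intro mult_le_mono1) simp
    finally have "real (slot j) \<le> real (nB * m) / real (P - h)"
      unfolding slot_def
      by (metis div_le_mono less_imp_le_nat of_nat_div_le_of_nat of_nat_mono order_trans)
    then have "(real (slot j) + 1) * exec_time B 1 \<le> (nB * m / (P - h) + 1) * exec_time B 1"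
      using positive h by (intro mult_right_mono) (auto simp: of_nat_diff)
    then show ?thesis using completion_bulk False by simp
  qed
qed

end

section \<open>From the stages to an inequality between area and stretch\<close>

lemma stages_bound:
  fixes P m h nB nC :: nat and e r :: real
  assumes alg: "online_list_algorithm M A" and r: "guarantees M A r" "0 \<le> r"
    and st: "offline_stages M P m X Y B C h e"
    and fit: "m * alloc A P B + alloc A P Y \<le> P" and block: "P < m * alloc A P B + alloc A P X"
  shows "nB * exec_time B (alloc A P B) + nC * exec_time C (alloc A P C) \<le>
     r * (2 * nB * e + max (nC * exec_time C h) ((nB * m / (P - h) + 1) * exec_time B 1))"
proof -
  interpret offline_stages M P m nB nC X Y B C h e by fact
  obtain S where S: "produced M A P graph S" and le: "makespan graph S \<le> r * makespan graph offline"
    using guarantees_produced[OF alg r(1) P graph_model offline_feasible] by blast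
  interpret produced M A P graph S by fact
  interpret produced_stages M P m nB nC X Y B C A S by unfold_locales (fact fit block)+
  have "r * makespan graph offline \<le>
     r * (2 * nB * e + max (nC * exec_time C h) ((nB * m / (P - h) + 1) * exec_time B 1))"
    using offline_makespan r(2) by (intro mult_left_mono)
  then show ?thesis using le makespan_ge by linarith
qed


text \<open>The numbers of stages tend to infinity in the proportion for which the chain of tasks \<open>C\<close> and
  the tasks \<open>B\<close> take the same time in the offline schedule.\<close>

lemma stages_ratio:
  fixes P m h :: nat and e r :: real
  assumes alg: "online_list_algorithm M A" and r: "guarantees M A r" "0 \<le> r"
    and st: "offline_stages M P m X Y B C h e"
    and fit: "m * alloc A P B + alloc A P Y \<le> P" and block: "P < m * alloc A P B + alloc A P X"
  defines "u \<equiv> (real P - real h) / (m * exec_time B 1)"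
  shows "u * exec_time B (alloc A P B) + exec_time C (alloc A P C) / exec_time C h \<le> r * (1 + 2 * u * e)"
proof (rule ccontr)
  assume neg: "\<not> ?thesis"
  define v where "v = 1 / exec_time C h"
  define tB where "tB = exec_time B (alloc A P B)"
  define tC where "tC = exec_time C (alloc A P C)"
  \<comment> \<open>With about \<open>u * N\<close> blocking and \<open>v * N\<close> chain stages,
    the bound is violated by \<open>N * D\<close> up to an error \<open>K\<close>: the floors cost
    \<open>tB + tC\<close>, the last slot \<open>r * exec_time B 1\<close>. A large \<open>N\<close>
    is a contradiction.\<close>
  define D where "D = u * tB + v * tC - r * (1 + 2 * u * e)"
  define K where "K = tB + tC + r * exec_time B 1"
  have "0 < D" using neg by (simp add: D_def v_def tB_def tC_def)
  then obtain N :: nat where N: "K < N * D" using reals_Archimedean3 by blast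
  interpret offline_stages M P m 0 0 X Y B C h e by fact
  have pos: "0 < tB" "0 < tC" "0 < u" "0 < v"
    using alloc_range[OF alg P] XYBC positive h m by (auto simp: tB_def tC_def follows_model_def u_def v_def)
  define nB where "nB = nat \<lfloor>u * N\<rfloor>"
  define nC where "nC = nat \<lfloor>v * N\<rfloor>"
  have nB: "nB \<le> u * N" "u * N - 1 \<le> nB" and nC: "nC \<le> v * N" "v * N - 1 \<le> nC"
    using pos by (simp_all add: nB_def nC_def)
  have "(u * N - 1) * tB + (v * N - 1) * tC \<le> nB * tB + nC * tC"
    using nB nC pos by (intro add_mono mult_right_mono) auto
  also have "\<dots> \<le> r * (2 * nB * e + max (nC * exec_time C h) ((nB * m / (P - h) + 1) * exec_time B 1))"
    unfolding tB_def tC_def by (rule stages_bound[OF alg r st fit block])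
  also have "\<dots> \<le> r * (2 * (u * N) * e + (N + exec_time B 1))"
  proof (intro mult_left_mono add_mono mult_right_mono max.boundedI)
    have "nC * exec_time C h \<le> (v * N) * exec_time C h"
      using nC positive by (intro mult_right_mono) auto
    then show "nC * exec_time C h \<le> N + exec_time B 1"
      using positive by (simp add: v_def)
    have "real nB * real m * exec_time B 1 \<le> (u * N) * m * exec_time B 1"
      using nB positive by (intro mult_right_mono) auto
    also have "\<dots> = (real P - real h) * N" using positive m by (simp add: u_def)
    finally show "(nB * m / (P - h) + 1) * exec_time B 1 \<le> N + exec_time B 1"
      using h by (simp add: of_nat_diff field_simps)
  qed (use nB positive r in auto)
  finally have "N * D \<le> K" by (simp add: D_def K_def algebra_simps)
  then show False using N by simp
qed

text \<open>Arbitrarily short tasks: \<open>X\<close> is perfectly parallel and so must get many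
  processors, while \<open>Y\<close> gains nothing from parallelism and so must get few.\<close>

lemma short_tasks:
  assumes "0 < e" "P \<ge> 1"
  obtains X Y where "follows_model M P X" "follows_model M P Y"
    "\<And>p. p \<in> {1..P} \<Longrightarrow> exec_time X p = e / p" "exec_time Y 1 = e"
    "\<And>p. p \<in> {1..P} \<Longrightarrow> e \<le> exec_time Y p"
proof (cases M)
  case Roofline
  show ?thesis
    by (rule that[of "SRoofline e P" "SRoofline e 1"])
      (use assms Roofline in \<open>auto simp: follows_model_def\<close>)
next
  case Communication
  have comm: "e \<le> exec_time (SCommunication e e) p" if "p \<in> {1..P}" for p
  proof -
    have "0 \<le> (real p - 1)\<^sup>2" by simp
    then have "1 \<le> 1 / p + (real p - 1)"
      using that by (simp add: field_simps power2_eq_square)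
    then have "e * 1 \<le> e * (1 / p + (real p - 1))" using assms by (intro mult_left_mono) auto
    then show ?thesis by (simp add: algebra_simps)
  qed
  show ?thesis
  proof (rule that[of "SCommunication e 0" "SCommunication e e"])
    show "follows_model M P (SCommunication e e)"
      unfolding follows_model_def using comm assms Communication by (fastforce simp del: exec_time.simps)
  qed (use assms Communication comm in \<open>auto simp: follows_model_def\<close>)
next
  case Amdahl
  show ?thesis
    by (rule that[of "SAmdahl e 0" "SAmdahl 0 e"])
      (use assms Amdahl in \<open>auto simp: follows_model_def\<close>)
qed

text \<open>Blocking \<open>X\<close> takes about \<open>P * (1 - 1 / r)\<close> processors, so
  \<open>m\<close> times the allocation of \<open>B\<close> is about \<open>P / \<kappa>\<close>
  with \<open>\<kappa> = r / (r - 1)\<close>. The first term of \<open>stages_ratio\<close> then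
  tends to \<open>\<kappa>\<close> times the area factor of \<open>B\<close>. The cap
  \<open>Q\<close> makes the errors vanish uniformly in \<open>B\<close> and
  \<open>C\<close>.\<close>

lemma area_stretch_tradeoff:
  fixes r d :: real and Q h :: nat
  assumes alg: "online_list_algorithm M A" and gr: "guarantees M A r" and r: "2 \<le> r"
    and h: "1 \<le> h" and d: "0 < d"
  obtains P0 where "\<And>P B C. P0 \<le> P \<Longrightarrow> follows_model M P B \<Longrightarrow> follows_model M P C \<Longrightarrow>
    alloc A P B \<le> Q \<Longrightarrow> 1 \<le> exec_time B 1 \<Longrightarrow>
    alloc A P B * exec_time B (alloc A P B) / exec_time B 1 * (r / (r - 1)) +
      exec_time C (alloc A P C) / exec_time C h \<le> r + d"
proof -
  \<comment> \<open>The summands ensure \<open>h < P\<close>, room for \<open>Y\<close> next to the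
    \<open>B\<close>, and an error of order \<open>1 / P\<close> below \<open>d / 2\<close>.\<close>
  define P0 where "P0 = Suc h + nat \<lceil>r * (Q + r + 1)\<rceil> + nat \<lceil>8 * r * (2 * Q + h) / d\<rceil>"
  define \<kappa> where "\<kappa> = r / (r - 1)"
  \<comment> \<open>Since \<open>u \<le> 2 * Q\<close> below, the short tasks contribute at most the
    other \<open>d / 2\<close>.\<close>
  define e where "e = d / (8 * r * (Q + 1))"
  have \<kappa>: "1 \<le> \<kappa>" "\<kappa> \<le> 2" using r by (simp_all add: \<kappa>_def field_simps)
  have e: "0 < e" using r d by (simp add: e_def)
  show thesis
  proof (rule that[of P0])
    fix P B C
    assume P0: "P0 \<le> P" and BC: "follows_model M P B" "follows_model M P C"
      and Q: "alloc A P B \<le> Q" and B1: "1 \<le> exec_time B 1"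
    have P: "P \<ge> 1" "h < P" using P0 by (auto simp: P0_def)
    have Pr: "r * (Q + r + 1) \<le> P" "8 * r * (2 * Q + h) / d \<le> P"
      using P0 unfolding P0_def by linarith+
    obtain X Y where XY: "follows_model M P X" "follows_model M P Y"
      "\<And>p. p \<in> {1..P} \<Longrightarrow> exec_time X p = e / p" "exec_time Y 1 = e"
      "\<And>p. p \<in> {1..P} \<Longrightarrow> e \<le> exec_time Y p" using short_tasks[OF e P(1)] by blast
    note range = alloc_range[OF alg P(1)]
    define q where "q = alloc A P B"
    define t where "t = exec_time B q"
    define b where "b = exec_time B 1"
    have q: "1 \<le> q" "q \<le> Q" using range[OF BC(1)] Q by (auto simp: q_def)
    have t: "0 < t" using range[OF BC(1)] BC(1) by (auto simp: t_def q_def follows_model_def)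
    have b: "1 \<le> b" using B1 by (simp add: b_def)
    have Y: "alloc A P Y \<le> r + 1"
    proof -
      have "(real (alloc A P Y) - 1) * e \<le> (real (alloc A P Y) - 1) * exec_time Y (alloc A P Y)"
        using XY(5) range[OF XY(2)] by (intro mult_left_mono) auto
      also have "\<dots> \<le> r * e"
        using identical_tasks_allocation[OF alg gr P(1) XY(2)] XY(4) by simp
      finally show ?thesis using e by simp
    qed
    define p0 where "p0 = nat \<lceil>P / r\<rceil>"
    have "P / r \<le> alloc A P X"
      using single_task_allocation[OF alg gr P(1) XY(1,3)] r by (simp add: field_simps)
    then have p0: "p0 \<le> alloc A P X" "P / r \<le> p0" unfolding p0_def by linarith+
    have "real P * 1 \<le> real P * r" using r by (intro mult_left_mono) auto
    then have "P / r \<le> P" using r by (simp add: field_simps)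
    then have p0P: "p0 \<le> P" unfolding p0_def by linarith
    have "Q + r + 1 \<le> P / r" using Pr(1) r by (simp add: field_simps)
    then have "real (q + alloc A P Y) \<le> real p0" using p0 q Y by simp
    then have qY: "q + alloc A P Y \<le> p0" by linarith
    \<comment> \<open>The least number of \<open>B\<close> that leaves fewer than \<open>p0\<close>
      processors. The overshoot is at most \<open>q\<close>, so \<open>Y\<close> still fits by
      \<open>qY\<close>.\<close>
    define m where "m = (P - p0) div q + 1"
    have "(P - p0) div q * q \<le> P - p0" by simp
    moreover have "P - p0 < m * q"
      unfolding m_def using q by (metis Suc_eq_plus1 dividend_less_div_times mult_Suc add.commute less_le_trans zero_less_one)
    ultimately have mq: "m * q \<le> P - p0 + q" "P - p0 < m * q" by (simp_all add: m_def)
    have fit: "m * alloc A P B + alloc A P Y \<le> P" "P < m * alloc A P B + alloc A P X"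
      using mq qY p0P p0 unfolding q_def by linarith+
    have st: "offline_stages M P m X Y B C h e"
      by unfold_locales (use P XY BC h XY(3)[of 1] in \<open>auto simp: m_def\<close>)
    define u where "u = (real P - real h) / (m * b)"
    have m: "1 \<le> m" by (simp add: m_def)
    have ratio: "u * t + exec_time C (alloc A P C) / exec_time C h \<le> r * (1 + 2 * u * e)"
      using stages_ratio[OF alg gr _ st fit] r unfolding u_def t_def b_def q_def by simp
    define z where "z = real (m * q)"
    have "real P - P / r = P / \<kappa>" using r by (simp add: \<kappa>_def field_simps)
    moreover have "0 \<le> P / r" using r by simp
    then have "real p0 \<le> P / r + 1" unfolding p0_def by linarith
    moreover have "P + 1 \<le> m * q + p0" "m * q + p0 \<le> P + Q" using mq p0P q by linarith+
    then have "real P + 1 \<le> z + p0" "z + p0 \<le> real P + Q"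
      unfolding z_def by (metis of_nat_1 of_nat_add of_nat_mono)+
    ultimately have z: "P / \<kappa> \<le> z" "z \<le> P / \<kappa> + Q" using p0(2) by linarith+
    have "0 < P / \<kappa>" using P \<kappa> by simp
    then have z0: "0 < z" using z by linarith
    have "u \<le> 2 * real Q"
    proof -
      have "u = (real P - real h) * q / (z * b)"
        using q by (simp add: u_def z_def)
      also have "\<dots> \<le> (real P * real q) / (P / \<kappa>)"
      proof (rule frac_le)
        show "(real P - real h) * real q \<le> real P * real q" by (intro mult_right_mono) auto
        have "z * 1 \<le> z * b" using z0 b by (intro mult_left_mono) auto
        then show "P / \<kappa> \<le> z * b" using z(1) by simp
      qed (use \<open>0 < P / \<kappa>\<close> in auto)
      also have "\<dots> = \<kappa> * q" using P by simp
      also have "\<dots> \<le> 2 * real Q" using \<kappa> q by (intro mult_mono) auto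
      finally show ?thesis .
    qed
    then have "r * (2 * u * e) \<le> r * (2 * (2 * real Q) * e)"
      using r e by (intro mult_left_mono mult_right_mono) auto
    also have "r * (2 * (2 * real Q) * e) = d / 2 * (Q / (Q + 1))"
    proof -
      have "r * (8 * e) = d / (real Q + 1)"
        using r by (simp add: e_def add.commute)
      then have "r * (8 * e) * Q / 2 = d / (real Q + 1) * Q / 2" by simp
      then show ?thesis by (simp add: algebra_simps)
    qed
    also have "\<dots> \<le> d / 2 * 1" using d by (intro mult_left_mono) auto
    finally have err1: "r * (2 * u * e) \<le> d / 2" by simp
    define \<alpha> where "\<alpha> = q * t / b"
    \<comment> \<open>A bound on the area factor \<open>\<alpha>\<close> that does not depend on
      \<open>P\<close>; for \<open>q \<ge> 2\<close> it uses
      \<open>q \<le> 2 * (q - 1)\<close>.\<close>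
    have "q * t \<le> 2 * r * b"
    proof (cases "q = 1")
      case True
      then show ?thesis using r b by (simp add: t_def b_def)
    next
      case False
      then have "real q * t \<le> 2 * (real q - 1) * t" using q t by (intro mult_right_mono) auto
      also have "\<dots> = 2 * ((real q - 1) * t)" by simp
      also have "\<dots> \<le> 2 * (r * b)"
        using identical_tasks_allocation[OF alg gr P(1) BC(1)] unfolding t_def q_def b_def
        by (intro mult_left_mono) auto
      finally show ?thesis by simp
    qed
    then have \<alpha>: "0 \<le> \<alpha>" "\<alpha> \<le> 2 * r" using t b q by (simp_all add: \<alpha>_def field_simps)
    \<comment> \<open>Collects the overshoot of the \<open>B\<close> and the \<open>h\<close>
      processors reserved for the chain; the outer 2 comes from
      \<open>z \<ge> P / 2\<close>.\<close>
    define c where "c = 2 * (2 * real Q + h)"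
    have "\<kappa> - c / P \<le> (real P - real h) / z"
    proof -
      have "\<kappa> * z \<le> \<kappa> * (P / \<kappa> + Q)" using z \<kappa> by (intro mult_left_mono) auto
      also have "\<dots> = P + \<kappa> * Q" using \<kappa> by (simp add: field_simps)
      also have "\<dots> \<le> real P + 2 * real Q" using \<kappa> by (intro add_mono mult_right_mono) auto
      finally have 1: "\<kappa> * z \<le> real P + 2 * real Q" by simp
      have "c / 2 \<le> c / \<kappa>" using \<kappa> by (intro divide_left_mono) (auto simp: c_def)
      also have "\<dots> = c / P * (P / \<kappa>)" using P by simp
      also have "\<dots> \<le> c / P * z" using z by (intro mult_left_mono) (auto simp: c_def)
      finally have "(\<kappa> - c / P) * z \<le> real P - real h"
        using 1 by (simp add: left_diff_distrib c_def)
      then show ?thesis using z0 by (simp add: pos_le_divide_eq)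
    qed
    then have "\<alpha> * (\<kappa> - c / P) \<le> \<alpha> * ((real P - real h) / z)"
      using \<alpha> by (intro mult_left_mono) auto
    also have "\<dots> = u * t" using q b m by (simp add: \<alpha>_def u_def z_def mult_ac)
    finally have "\<alpha> * \<kappa> - \<alpha> * (c / P) \<le> u * t" by (simp add: right_diff_distrib)
    moreover have "\<alpha> * (c / P) \<le> 2 * r * (c / P)" using \<alpha> by (intro mult_right_mono) (auto simp: c_def)
    moreover have "2 * r * (c / P) \<le> d / 2"
      using Pr(2) d P by (simp add: c_def field_simps)
    ultimately show "alloc A P B * exec_time B (alloc A P B) / exec_time B 1 * (r / (r - 1)) +
      exec_time C (alloc A P C) / exec_time C h \<le> r + d"
      using ratio err1 by (simp add: \<alpha>_def \<kappa>_def q_def t_def b_def distrib_left)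
  qed
qed


section \<open>The three speedup models\<close>

text \<open>\<open>B\<close> and \<open>C\<close> are both the task that takes time 1 on any number
  \<open>q\<close> of processors: the stretch is 1 and the area factor
  \<open>q \<ge> 1\<close>.\<close>

lemma roofline_guarantee:
  assumes alg: "online_list_algorithm Roofline A" and gr: "guarantees Roofline A r" and r: "2 \<le> r"
  shows "1 + r / (r - 1) \<le> r"
proof (rule field_le_epsilon)
  fix d :: real assume d: "0 < d"
  obtain P where P: "\<And>B C. follows_model Roofline P B \<Longrightarrow> follows_model Roofline P C \<Longrightarrow>
      alloc A P B \<le> nat \<lceil>r + 1\<rceil> \<Longrightarrow> 1 \<le> exec_time B 1 \<Longrightarrow>
      alloc A P B * exec_time B (alloc A P B) / exec_time B 1 * (r / (r - 1)) +
      exec_time C (alloc A P C) / exec_time C 1 \<le> r + d" and "P \<ge> 1"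
    using area_stretch_tradeoff[OF alg gr r order_refl d, of "nat \<lceil>r + 1\<rceil>"] by (metis nat_le_linear)
  let ?s = "SRoofline 1 1"
  have s: "follows_model Roofline P ?s" using \<open>P \<ge> 1\<close> by (simp add: follows_model_def)
  define q where "q = alloc A P ?s"
  have q: "1 \<le> q" using alloc_range[OF alg \<open>P \<ge> 1\<close> s] by (simp add: q_def)
  have "real q - 1 \<le> r"
    using identical_tasks_allocation[OF alg gr \<open>P \<ge> 1\<close> s] q by (simp add: q_def)
  then have "q * (r / (r - 1)) + 1 \<le> r + d"
    using P[OF s s] q unfolding q_def by (simp add: le_nat_iff) linarith
  moreover have "1 * (r / (r - 1)) \<le> q * (r / (r - 1))"
    using q r by (intro mult_right_mono) auto
  ultimately show "1 + r / (r - 1) \<le> r + d" by simp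
qed

text \<open>A discrete intermediate value argument over tasks with overhead 1 and works on a fine
  grid from 2 to 16. If the allocation exceeds one at work 2 or is still one at work 16, a single
  task is bad enough; otherwise it leaves one between two neighbours, and the smaller serves as
  \<open>C\<close>, the larger as \<open>B\<close>.\<close>

lemma communication_guarantee:
  assumes alg: "online_list_algorithm Communication A" and gr: "guarantees Communication A r"
    and r: "2 \<le> r" "r \<le> 4"
  shows "3 / 2 + 4 / 3 * (r / (r - 1)) \<le> r"
proof (rule field_le_epsilon)
  fix d' :: real assume "0 < d'"
  define d where "d = d' / 2"
  have d: "0 < d" using \<open>0 < d'\<close> by (simp add: d_def)
  define \<kappa> where "\<kappa> = r / (r - 1)"
  have \<kappa>: "4 / 3 \<le> \<kappa>" "\<kappa> \<le> 2" using r by (simp_all add: \<kappa>_def field_simps)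
  define Q where "Q = nat \<lceil>16 * r + 1\<rceil>"
  \<comment> \<open>One \<open>P\<close> for all cases, in which the offline chain uses one, two or
    three processors.\<close>
  obtain P where P: "\<And>h B C. h \<in> {1, 2, 3} \<Longrightarrow> follows_model Communication P B \<Longrightarrow>
      follows_model Communication P C \<Longrightarrow> alloc A P B \<le> Q \<Longrightarrow> 1 \<le> exec_time B 1 \<Longrightarrow>
      alloc A P B * exec_time B (alloc A P B) / exec_time B 1 * \<kappa> +
      exec_time C (alloc A P C) / exec_time C h \<le> r + d" and P1: "P \<ge> 1"
  proof -
    define ok where "ok h P \<longleftrightarrow> (\<forall>B C. follows_model Communication P B \<longrightarrow>
      follows_model Communication P C \<longrightarrow> alloc A P B \<le> Q \<longrightarrow> 1 \<le> exec_time B 1 \<longrightarrow>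
      alloc A P B * exec_time B (alloc A P B) / exec_time B 1 * \<kappa> +
      exec_time C (alloc A P C) / exec_time C h \<le> r + d)" for h P
    have "\<exists>P0. \<forall>P\<ge>P0. ok h P" if "1 \<le> h" for h
      using area_stretch_tradeoff[OF alg gr r(1) that d, of Q] unfolding ok_def \<kappa>_def by metis
    then obtain P1 P2 P3 where "\<forall>P\<ge>P1. ok 1 P" "\<forall>P\<ge>P2. ok 2 P" "\<forall>P\<ge>P3. ok 3 P"
      by (metis one_le_numeral order_refl)
    then have ok: "\<forall>h\<in>{1, 2, 3}. ok h (P1 + P2 + P3 + 1)" by simp
    show thesis
    proof (rule that[of "P1 + P2 + P3 + 1"])
      fix h :: nat assume "h \<in> {1, 2, 3}"
      from bspec[OF ok this]
      show "\<And>B C. follows_model Communication (P1 + P2 + P3 + 1) B \<Longrightarrow>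
        follows_model Communication (P1 + P2 + P3 + 1) C \<Longrightarrow> alloc A (P1 + P2 + P3 + 1) B \<le> Q \<Longrightarrow>
        1 \<le> exec_time B 1 \<Longrightarrow>
        alloc A (P1 + P2 + P3 + 1) B * exec_time B (alloc A (P1 + P2 + P3 + 1) B) / exec_time B 1 * \<kappa> +
        exec_time C (alloc A (P1 + P2 + P3 + 1) C) / exec_time C h \<le> r + d"
        unfolding ok_def by blast
    qed simp
  qed
  define n where "n = nat \<lceil>14 / d\<rceil>"
  have "0 < 14 / d" using d by simp
  then have n: "14 / d \<le> n" "0 < n" unfolding n_def by linarith+
  define \<delta> where "\<delta> = 14 / n"
  have \<delta>: "0 < \<delta>" "\<delta> \<le> d" using n d by (simp_all add: \<delta>_def field_simps)
  define w where "w i = 2 + real i * \<delta>" for i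
  define s where "s i = SCommunication (w i) 1" for i
  define q where "q i = alloc A P (s i)" for i
  have w2: "2 \<le> w i" for i using \<delta> by (simp add: w_def)
  have w16: "w i \<le> 16" if "i \<le> n" for i
    using that n mult_right_mono[of "real i" n "14 / n"] by (simp add: w_def \<delta>_def)
  have fs: "follows_model Communication P (s i)" for i
    using w2[of i] by (auto simp: follows_model_def s_def intro!: add_pos_nonneg)
  have q1: "1 \<le> q i" for i using alloc_range[OF alg P1 fs] by (auto simp: q_def)
  have qQ: "q i \<le> Q" if "i \<le> n" for i
  proof -
    have "real q * 1 \<le> real q * real q" for q :: nat by (cases q) auto
    from this[of "q i - 1"] have "real (q i) - 1 \<le> (real (q i) - 1) * (real (q i) - 1)"
      using q1[of i] by (simp add: of_nat_diff)
    also have "\<dots> \<le> (real (q i) - 1) * exec_time (s i) (q i)"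
      using q1[of i] w2[of i] by (intro mult_left_mono) (auto simp: s_def)
    also have "\<dots> \<le> r * w i"
      using identical_tasks_allocation[OF alg gr P1 fs[of i]] by (simp add: q_def s_def)
    also have "\<dots> \<le> r * 16" using r w16[OF that] by (intro mult_left_mono) auto
    finally show ?thesis unfolding Q_def by linarith
  qed
  have bound: "(1 + q i * (real (q i) - 1) / w i) * \<kappa> + exec_time (s j) (q j) / exec_time (s j) h \<le> r + d"
    if "i \<le> n" "h \<in> {1, 2, 3}" for i j h
  proof -
    have "q i * exec_time (s i) (q i) / exec_time (s i) 1 = 1 + q i * (real (q i) - 1) / w i"
      using q1[of i] w2[of i] by (simp add: s_def field_simps)
    then show ?thesis
      using P[OF that(2) fs[of i] fs[of j]] qQ[OF that(1)] w2[of i] by (simp add: q_def s_def)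
  qed
  have area: "2 / w i \<le> q i * (real (q i) - 1) / w i" if "q i \<noteq> 1" for i
  proof -
    have "2 * 1 \<le> q i * (real (q i) - 1)"
      using q1[of i] that by (intro mult_mono) auto
    then show ?thesis using w2[of i] by (intro divide_right_mono) auto
  qed
  consider "q 0 \<noteq> 1" | "q n = 1" | i where "i < n" "q i = 1" "q (Suc i) \<noteq> 1"
  proof -
    have "\<exists>i<n. q i = 1 \<and> q (Suc i) \<noteq> 1" if "q 0 = 1" "q n \<noteq> 1"
    proof (rule ccontr)
      assume no: "\<not> ?thesis"
      have "i \<le> n \<Longrightarrow> q i = 1" for i by (induction i) (use that no in auto)
      then show False using that by simp
    qed
    then show thesis using that by blast
  qed
  then have "3 / 2 + 4 / 3 * \<kappa> \<le> r + d'"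
  proof cases
    case 1
    have "0 \<le> (real (q 0) - 1) * (real (q 0) - 2)"
      using q1[of 0] 1 by (intro mult_nonneg_nonneg) auto
    then have stretch: "1 \<le> exec_time (s 0) (q 0) / exec_time (s 0) 1"
      using q1[of 0] by (simp add: s_def w_def field_simps)
    have "(1 + 1) * \<kappa> \<le> (1 + q 0 * (real (q 0) - 1) / w 0) * \<kappa>"
      using area[OF 1] \<kappa> by (intro mult_right_mono add_mono) (auto simp: w_def)
    from add_mono[OF this stretch] bound[of 0 1 0] have "(1 + 1) * \<kappa> + 1 \<le> r + d"
      by (meson insertI1 le0 order_trans)
    then have "2 * \<kappa> + 1 \<le> r + d" by simp
    moreover have "d \<le> d'" using d by (simp add: d_def)
    ultimately show ?thesis using \<kappa> by linarith
  next
    case 2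
    have "w n = 16" using n by (simp add: w_def \<delta>_def)
    then have "exec_time (s n) (q n) / exec_time (s n) 3 = 24 / 11" using 2 by (simp add: s_def)
    then show ?thesis using bound[of n 3 n] 2 \<kappa> d by (simp add: d_def)
  next
    case (3 i)
    define x where "x = w i"
    have x: "2 \<le> x" using w2 by (simp add: x_def)
    \<comment> \<open>Replacing the work of \<open>B\<close> by that of its neighbour
      \<open>C\<close> costs at most \<open>d\<close>.\<close>
    have "2 / x - 2 / (x + \<delta>) = 2 * \<delta> / (x * (x + \<delta>))" using x \<delta> by (simp add: field_simps)
    also have "\<dots> \<le> 2 * \<delta> / (2 * 2)" using x \<delta> by (intro divide_left_mono mult_mono) auto
    finally have "2 / x - 2 / (x + \<delta>) \<le> \<delta> / 2" by simp
    moreover have "0 \<le> 2 / x - 2 / (x + \<delta>)" using x \<delta> by (simp add: frac_le)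
    ultimately have "\<kappa> * (2 / x - 2 / (x + \<delta>)) \<le> 2 * (\<delta> / 2)"
      using \<kappa> by (intro mult_mono) auto
    then have close: "2 / x * \<kappa> - d \<le> 2 / (x + \<delta>) * \<kappa>" using \<delta> by (simp add: algebra_simps)
    have wS: "w (Suc i) = x + \<delta>" by (simp add: w_def x_def algebra_simps)
    have "2 / (x + \<delta>) * \<kappa> \<le> q (Suc i) * (real (q (Suc i)) - 1) / w (Suc i) * \<kappa>"
      using area[OF 3(3)] \<kappa> unfolding wS by (intro mult_right_mono) auto
    then have main: "\<kappa> + 2 / x * \<kappa> + exec_time (s i) 1 / exec_time (s i) h \<le> r + 2 * d" if "h \<in> {1, 2, 3}" for h
      using bound[of "Suc i" h i] that 3 close by (simp add: distrib_right)
    have "3 / 2 + 4 / 3 * \<kappa> \<le> r + 2 * d"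
    \<comment> \<open>At work 6 two and three processors take the same time 4, against 6 on one
      processor. Each bound equals the claimed value there, so the difference has the factor
      \<open>x - 6\<close>; the bounds on \<open>\<kappa>\<close> give the sign of the
      cofactor.\<close>
    proof (cases "x \<le> 6")
      case True
      have "\<kappa> + 2 / x * \<kappa> + 2 * x / (x + 2) - (3 / 2 + 4 / 3 * \<kappa>) =
          (6 - x) * (2 * \<kappa> * (x + 2) - 3 * x) / (6 * x * (x + 2))"
        using x by (simp add: divide_simps) (simp add: algebra_simps)
      moreover have "4 / 3 * (x + 2) \<le> \<kappa> * (x + 2)" using \<kappa> x by (intro mult_right_mono) auto
      then have "0 \<le> (6 - x) * (2 * \<kappa> * (x + 2) - 3 * x)"
        using True x by (intro mult_nonneg_nonneg) (auto simp: algebra_simps)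
      then have "0 \<le> (6 - x) * (2 * \<kappa> * (x + 2) - 3 * x) / (6 * x * (x + 2))" using x by simp
      moreover have "exec_time (s i) 1 / exec_time (s i) 2 = 2 * x / (x + 2)"
        using x by (simp add: s_def x_def[symmetric] field_simps)
      ultimately show ?thesis using main[of 2] by simp
    next
      case False
      have "\<kappa> + 2 / x * \<kappa> + 3 * x / (x + 6) - (3 / 2 + 4 / 3 * \<kappa>) =
          (x - 6) * (9 * x - 2 * \<kappa> * (x + 6)) / (6 * x * (x + 6))"
        using x by (simp add: divide_simps) (simp add: algebra_simps)
      moreover have "\<kappa> * (x + 6) \<le> 2 * (x + 6)" using \<kappa> x by (intro mult_right_mono) auto
      then have "0 \<le> (x - 6) * (9 * x - 2 * \<kappa> * (x + 6))"
        using False by (intro mult_nonneg_nonneg) (auto simp: algebra_simps)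
      then have "0 \<le> (x - 6) * (9 * x - 2 * \<kappa> * (x + 6)) / (6 * x * (x + 6))" using x by simp
      moreover have "exec_time (s i) 1 / exec_time (s i) 3 = 3 * x / (x + 6)"
        using x by (simp add: s_def x_def[symmetric] field_simps)
      ultimately show ?thesis using main[of 3] by simp
    qed
    then show ?thesis by (simp add: d_def)
  qed
  then show "3 / 2 + 4 / 3 * (r / (r - 1)) \<le> r + d'" by (simp add: \<kappa>_def)
qed

text \<open>One task with sequential time 1 and large work \<open>w\<close> serves as
  \<open>B\<close> and \<open>C\<close>. With \<open>y = q / w\<close> the trade-off tends to
  \<open>(1 + y) * \<kappa> + 1 + 1 / y\<close>, which is minimal at
  \<open>y = 1 / sqrt \<kappa>\<close>.\<close>

lemma amdahl_guarantee:
  assumes alg: "online_list_algorithm Amdahl A" and gr: "guarantees Amdahl A r" and r: "2 \<le> r"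
  shows "(1 + sqrt (r / (r - 1)))\<^sup>2 \<le> r"
proof (rule field_le_epsilon)
  fix d' :: real assume "0 < d'"
  define \<kappa> where "\<kappa> = r / (r - 1)"
  have \<kappa>: "1 \<le> \<kappa>" "\<kappa> \<le> 2" using r by (simp_all add: \<kappa>_def field_simps)
  define d where "d = d' / 4"
  have d: "0 < d" using \<open>0 < d'\<close> by (simp add: d_def)
  define w where "w = nat \<lceil>r / d\<rceil> + 1"
  have w: "1 \<le> w" "r / d \<le> w" unfolding w_def by linarith+
  \<comment> \<open>Then the offline chain task takes \<open>1 + 1 / w\<close>, so area and stretch
    share the factor \<open>w / (w + 1)\<close>.\<close>
  define h where "h = w * w"
  have h: "1 \<le> h" using w by (simp add: h_def)
  let ?s = "SAmdahl (real w) 1"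
  define Q where "Q = nat \<lceil>r * (w + 1) + 1\<rceil>"
  obtain P where P: "\<And>B C. follows_model Amdahl P B \<Longrightarrow> follows_model Amdahl P C \<Longrightarrow>
      alloc A P B \<le> Q \<Longrightarrow> 1 \<le> exec_time B 1 \<Longrightarrow>
      alloc A P B * exec_time B (alloc A P B) / exec_time B 1 * \<kappa> +
      exec_time C (alloc A P C) / exec_time C h \<le> r + d" and P1: "P \<ge> 1"
    using area_stretch_tradeoff[OF alg gr r h d, of Q] unfolding \<kappa>_def by (metis nat_le_linear)
  have s: "follows_model Amdahl P ?s" by (auto simp: follows_model_def intro!: add_nonneg_pos)
  define q where "q = alloc A P ?s"
  have q: "1 \<le> q" using alloc_range[OF alg P1 s] by (simp add: q_def)
  have "(real q - 1) * 1 \<le> (real q - 1) * exec_time ?s q"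
    using q by (intro mult_left_mono) auto
  also have "\<dots> \<le> r * (w + 1)"
    using identical_tasks_allocation[OF alg gr P1 s] by (simp add: q_def add.commute)
  finally have "real q \<le> r * (w + 1) + 1" by simp
  also have "\<dots> \<le> Q" unfolding Q_def by (rule real_nat_ceiling_ge)
  finally have "q \<le> Q" by simp
  then have "q * (w / q + 1) / (w + 1) * \<kappa> + (w / q + 1) / (w / h + 1) \<le> r + d"
    using P[OF s s] by (simp add: q_def add.commute)
  moreover have "q * (w / q + 1) / (w + 1) * \<kappa> + (w / q + 1) / (w / h + 1) =
      w / (w + 1) * ((1 + q / w) * \<kappa> + (w / q + 1))"
  proof -
    have "real w / h + 1 = (w + 1) / w" using w by (simp add: h_def field_simps)
    then have C: "(w / q + 1) / (w / h + 1) = w / (w + 1) * (w / q + 1)" by simp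
    have "q * (w / q + 1) = w * (1 + q / w)" using q w by (simp add: field_simps)
    then have "q * (w / q + 1) / (w + 1) = w / (w + 1) * (1 + q / w)" by simp
    moreover have "a * b * k + a * c = a * (b * k + c)" for a b k c :: real by (simp add: algebra_simps)
    ultimately show ?thesis by (simp only: C)
  qed
  moreover have "y \<le> z * ((w + 1) / w)" if "w / (w + 1) * y \<le> z" for y z :: real
    using that w by (simp add: field_simps)
  ultimately have "(1 + q / w) * \<kappa> + (w / q + 1) \<le> (r + d) * ((w + 1) / w)"
    by metis
  moreover have "(1 + sqrt \<kappa>)\<^sup>2 \<le> (1 + q / w) * \<kappa> + (w / q + 1)"
  proof -
    define y where "y = real q / w"
    have y: "0 < y" using q w by (simp add: y_def)
    have "0 \<le> (y * sqrt \<kappa> - 1)\<^sup>2 / y" using y by simp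
    also have "\<dots> = y * (sqrt \<kappa>)\<^sup>2 + 1 / y - 2 * sqrt \<kappa>"
      using y by (simp add: power2_eq_square field_simps)
    finally have "(1 + sqrt \<kappa>)\<^sup>2 \<le> (1 + y) * \<kappa> + (1 / y + 1)"
      using \<kappa> by (simp add: power2_sum algebra_simps)
    then show ?thesis by (simp add: y_def)
  qed
  moreover have "(r + d) * ((w + 1) / w) \<le> r + d'"
  proof -
    have "r / w \<le> d" using w r d by (simp add: field_simps)
    moreover have "d / w \<le> d" using w d by (simp add: field_simps)
    moreover have "(r + d) * ((w + 1) / w) = r + d + r / w + d / w" using w by (simp add: field_simps)
    moreover have "d' = 4 * d" by (simp add: d_def)
    ultimately show ?thesis using d by linarith
  qed
  ultimately show "(1 + sqrt (r / (r - 1)))\<^sup>2 \<le> r + d'" by (simp add: \<kappa>_def)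
qed

section \<open>Solving the three inequalities for the ratio\<close>

theorem theorem6:
  fixes M :: model and A :: algorithm
  assumes "online_list_algorithm M A"
  shows "\<not> (\<exists>\<rho>::real. \<rho> < 1 / mu M \<and> competitive M A \<rho>)"
proof clarify
  fix \<rho> assume \<rho>: "\<rho> < 1 / mu M" "competitive M A \<rho>"
  \<comment> \<open>Raising the ratio to 2 is harmless, as \<open>1 / mu M\<close> exceeds 2 for
    each model.\<close>
  define r where "r = max \<rho> 2"
  have r: "2 \<le> r" by (simp add: r_def)
  have gr: "guarantees M A r" using competitive_guarantees[OF \<rho>(2)] by (simp add: r_def)
  show False
  proof (cases M)
    case Roofline
    have "sqrt 5 < 3" "2 < sqrt 5" by (auto intro: real_less_lsqrt real_less_rsqrt)
    then have "1 / mu M = (3 + sqrt 5) / 2" by (simp add: Roofline field_simps)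
    then have "2 * r - 3 < sqrt 5" using \<rho>(1) \<open>2 < sqrt 5\<close> by (auto simp: r_def max_def)
    \<comment> \<open>The guarantee amounts to \<open>r * r - 3 * r + 1 \<ge> 0\<close>; completing
      the square contradicts this.\<close>
    then have "(2 * r - 3)\<^sup>2 < (sqrt 5)\<^sup>2" using r by (intro power_strict_mono) auto
    moreover have "1 + r / (r - 1) \<le> r" using roofline_guarantee assms gr r Roofline by blast
    ultimately show False using r by (simp add: field_simps power2_eq_square)
  next
    case Communication
    have "sqrt 313 < 18" "1 < sqrt 313" by (auto intro: real_less_lsqrt real_less_rsqrt)
    then have "1 / mu M = (23 + sqrt 313) / 12" by (simp add: Communication field_simps)
    then have r': "12 * r - 23 < sqrt 313" using \<rho>(1) \<open>1 < sqrt 313\<close> by (auto simp: r_def max_def)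
    \<comment> \<open>Likewise for \<open>6 * r * r - 23 * r + 9 \<ge> 0\<close>.\<close>
    then have "(12 * r - 23)\<^sup>2 < (sqrt 313)\<^sup>2" using r by (intro power_strict_mono) auto
    moreover have "r \<le> 4" using r' \<open>sqrt 313 < 18\<close> by simp
    then have "3 / 2 + 4 / 3 * (r / (r - 1)) \<le> r"
      using communication_guarantee assms gr r Communication by blast
    ultimately show False using r by (simp add: field_simps power2_eq_square)
  next
    case Amdahl
    have sq: "11 / 8 < sqrt 2" "sqrt 2 < 3 / 2"
      by (rule real_less_rsqrt, simp add: power2_eq_square, rule real_less_lsqrt, simp_all add: power2_eq_square)
    define z where "z = sqrt (8 * sqrt 2 - 11)"
    have z: "0 < z" "z < 1" using sq by (auto simp: z_def)
    have "1 / mu M = 2 / (1 - z)" by (simp add: Amdahl z_def)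
    moreover have "2 < 2 / (1 - z)" using z by (simp add: field_simps)
    ultimately have "r < 2 / (1 - z)" using \<rho>(1) by (simp add: r_def)
    then have "1 - 2 / r < z" using r z by (simp add: field_simps)
    then have "(1 - 2 / r)\<^sup>2 < z\<^sup>2" using r by (intro power_strict_mono) auto
    then have 1: "3 - 2 * sqrt 2 < 1 / r * (1 - 1 / r)"
      using sq by (simp add: z_def power2_eq_square algebra_simps)
    \<comment> \<open>As the squares of \<open>a\<close> and \<open>b\<close> sum to 1, the
      guarantee \<open>a * b \<le> b - a\<close> squares to a quadratic inequality in
      \<open>a * b\<close> alone, giving \<open>a * b \<le> sqrt 2 - 1\<close>.\<close>
    define a where "a = sqrt (1 / r)"
    define b where "b = sqrt (1 - 1 / r)"
    have ab: "0 < a" "0 < b" "a\<^sup>2 = 1 / r" "b\<^sup>2 = 1 - 1 / r" using r by (simp_all add: a_def b_def)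
    have "r / (r - 1) = 1 / (1 - 1 / r)" using r by (simp add: field_simps)
    then have "sqrt (r / (r - 1)) = 1 / b" by (simp add: b_def real_sqrt_divide)
    then have "(1 + 1 / b)\<^sup>2 \<le> 1 / a\<^sup>2"
      using amdahl_guarantee[of A r] assms gr r Amdahl ab by simp
    then have "a\<^sup>2 * (1 + 1 / b)\<^sup>2 \<le> a\<^sup>2 * (1 / a\<^sup>2)" by (intro mult_left_mono) auto
    then have "(a * (1 + 1 / b))\<^sup>2 \<le> 1\<^sup>2" using ab(1) by (simp add: power_mult_distrib)
    then have "a * (1 + 1 / b) \<le> 1" by (rule power2_le_imp_le) simp
    then have "a * b \<le> b - a" using ab by (simp add: field_simps)
    then have "(a * b)\<^sup>2 \<le> (b - a)\<^sup>2" using ab by (intro power_mono) auto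
    also have "\<dots> = 1 - 2 * (a * b)" using ab by (simp add: power2_diff)
    finally have "(a * b + 1)\<^sup>2 \<le> (sqrt 2)\<^sup>2" by (simp add: power2_sum)
    then have "a * b + 1 \<le> sqrt 2" by (rule power2_le_imp_le) simp
    then have "(a * b)\<^sup>2 \<le> (sqrt 2 - 1)\<^sup>2" using ab by (intro power_mono) auto
    then show False using 1 ab by (simp add: power_mult_distrib power2_diff)
  qed
qed

end
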